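(* For every integer $n \geq 2$, $$\#\left\{ m\in\mathbb{Z}_{\geq 1} : \Gamma^{(n)}(m)\ \text{is algebraic}\right\} \leq n-1 .$$
   Context: $\Gamma$ denotes the Euler Gamma function and $\Gamma^{(n)}$ its $n$-th derivative. "Algebraic" means algebraic over $\mathbb{Q}$. $\#$ denotes the cardinality of a set (in particular the claim includes that the set is finite). *)

theory Defs
  imports "HOL-Analysis.Analysis" "HOL-Computational_Algebra.Computational_Algebra"
begin

end

theory Submission
  imports Defs "HOL-Complex_Analysis.Cauchy_Integral_Formula"
begin

text \<open>
  Write \<open>G j = \<Gamma>\<^sup>(\<^sup>j\<^sup>)(1) / j!\<close>.  Differentiating \<open>\<Gamma>(z + 1) = z \<Gamma>(z)\<close> repeatedly gives
  \<open>\<Gamma>\<^sup>(\<^sup>n\<^sup>)(M + 1) / (n! M!) = (\<Sum>i\<le>n. e\<^sub>i(M) G (n - i))\<close>, where \<open>e\<^sub>i(M)\<close> is the \<open>i\<close>-th elementary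
  symmetric function of \<open>1, 1/2, \<dots>, 1/M\<close>.  Since \<open>G 0 = 1\<close>, this is for fixed \<open>n\<close> a rational affine
  relation in the \<open>n\<close> unknowns \<open>G 1, \<dots>, G n\<close>.  Suppose \<open>\<Gamma>\<^sup>(\<^sup>n\<^sup>)\<close> were algebraic at \<open>n\<close> different
  positive integers.  If the resulting \<open>n \<times> n\<close> system is invertible, all of \<open>G 1, \<dots>, G n\<close> are
  algebraic, and as \<open>n \<ge> 2\<close> these include \<open>G 1 = - \<gamma>\<close> and \<open>G 2 = (\<gamma>\<^sup>2 + \<pi>\<^sup>2 / 6) / 2\<close>.  Then \<open>\<pi>\<^sup>2\<close>
  is algebraic, contradicting the transcendence of \<open>\<pi>\<close>.

  Two facts carry this argument.

  \<^item> Invertibility (\<open>harm_esym_columns_independent\<close>).  A dependency \<open>c\<close> between the columns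
    \<open>(e\<^sub>0(M), \<dots>, e\<^sub>n\<^sub>-\<^sub>1(M))\<close>, with \<open>M\<close> ranging over an \<open>n\<close>-element set, is a finitely supported
    sequence with \<open>(\<Sum>M. c M e\<^sub>i(M)) = 0\<close> for \<open>i < n\<close>.  By Abel summation, the sequence of partial
    sums of \<open>c\<close>, divided by \<open>M + 1\<close>, satisfies the same equations for \<open>i < n - 1\<close>, while passing
    to partial sums with total \<open>0\<close> loses at least one sign change.  So \<open>c \<noteq> 0\<close> would have at least
    \<open>n\<close> sign changes, hence at least \<open>n + 1\<close> nonzero terms: a discrete rule of signs.

  \<^item> Transcendence of \<open>\<pi>\<close>, in the form that \<open>exp z \<noteq> -1\<close> for algebraic \<open>z\<close>, along the lines of
    Lindemann and Niven.  If \<open>\<alpha>\<^sub>1, \<dots>, \<alpha>\<^sub>d\<close> are the roots of a rational polynomial vanishing at \<open>z\<close>,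
    then \<open>exp z = -1\<close> gives \<open>0 = (\<Prod>i. 1 + exp \<alpha>\<^sub>i) = k + (\<Sum>j. exp \<beta>\<^sub>j)\<close>, where the \<open>\<beta>\<^sub>j\<close> are the
    nonzero subset sums of the \<open>\<alpha>\<^sub>i\<close> and \<open>k \<ge> 1\<close>.  Hermite's auxiliary polynomials refute this as
    soon as all symmetric expressions in the \<open>\<beta>\<^sub>j\<close> are rational.  Their rationality needs only
    Newton's identities: applied to the formal power series \<open>e\<^sup>\<alpha>\<^sup>t\<close> in place of numbers, they show
    that \<open>\<Prod>i. 1 + exp (\<alpha>\<^sub>i t)\<close>, whose coefficients are the power sums of all subset sums up to
    factorials, has rational coefficients.
\<close>

section \<open>Linear relations and algebraic numbers\<close>

text \<open>
  More vectors than coordinates force a linear relation.  Used twice: to make powers of a number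
  dependent over the rationals, and to expand unit vectors in independent columns.
\<close>

lemma ex_linear_relation:
  fixes w :: "'k \<Rightarrow> 'i \<Rightarrow> 'a :: field"
  assumes "finite I" "finite K" "card I < card K"
  shows "\<exists>d. (\<exists>k\<in>K. d k \<noteq> 0) \<and> (\<forall>i\<in>I. (\<Sum>k\<in>K. d k * w k i) = 0)"
  using assms
proof (induction I arbitrary: K w rule: finite_induct)
  case empty
  then show ?case by (intro exI[of _ "\<lambda>_. 1"]) (auto simp: card_gt_0_iff)
next
  case (insert i I)
  show ?case
  proof (cases "\<forall>k\<in>K. w k i = 0")
    case True
    obtain d where "\<exists>k\<in>K. d k \<noteq> 0" "\<forall>j\<in>I. (\<Sum>k\<in>K. d k * w k j) = 0"
      using insert.IH[of K w] insert.prems insert.hyps by auto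
    then show ?thesis using True by (intro exI[of _ d]) auto
  next
    case False
    then obtain k0 where k0: "k0 \<in> K" "w k0 i \<noteq> 0" by blast
    define K' where "K' = K - {k0}"
    define w' where "w' = (\<lambda>k j. w k j - w k i / w k0 i * w k0 j)"
    have K: "K = insert k0 K'" "k0 \<notin> K'" "finite K'"
      using k0 insert.prems by (auto simp: K'_def)
    have "card I < card K'"
      using insert.prems insert.hyps K by simp
    then obtain d where d: "\<exists>k\<in>K'. d k \<noteq> 0" "\<And>j. j \<in> I \<Longrightarrow> (\<Sum>k\<in>K'. d k * w' k j) = 0"
      using insert.IH[of K' w'] K by blast
    define s where "s = (\<Sum>k\<in>K'. d k * w k i) / w k0 i"
    define d' where "d' = d(k0 := - s)"
    have sum_d': "(\<Sum>k\<in>K. d' k * w k j) = (\<Sum>k\<in>K'. d k * w k j) - s * w k0 j" for j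
    proof -
      have "(\<Sum>k\<in>K'. d' k * w k j) = (\<Sum>k\<in>K'. d k * w k j)"
        using K by (intro sum.cong) (auto simp: d'_def)
      then show ?thesis using K by (simp add: d'_def)
    qed
    have "(\<Sum>k\<in>K. d' k * w k j) = 0" if j: "j \<in> I" for j
    proof -
      have "(\<Sum>k\<in>K'. d k * w' k j) = (\<Sum>k\<in>K'. d k * w k j) - s * w k0 j"
        unfolding w'_def s_def right_diff_distrib sum_subtractf sum_divide_distrib sum_distrib_right
        by (simp add: mult_ac)
      then show ?thesis using d(2)[OF j] sum_d'[of j] by simp
    qed
    moreover have "(\<Sum>k\<in>K. d' k * w k i) = 0"
      using sum_d'[of i] k0 by (simp add: s_def)
    moreover have "\<exists>k\<in>K. d' k \<noteq> 0"
      using d(1) K by (auto simp: d'_def)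
    ultimately show ?thesis by (intro exI[of _ d']) auto
  qed
qed

text \<open>
  The powers of \<open>z\<close> lie in a rational space of dimension at most \<open>card I\<close>, so the first
  \<open>card I + 1\<close> of them are dependent; a dependency is a polynomial equation for \<open>z\<close>.
\<close>

lemma algebraic_if_powers_in_rational_span:
  fixes z :: "'a :: field_char_0" and W :: "nat \<Rightarrow> 'i \<Rightarrow> rat"
  assumes "finite I" and powers: "\<And>k. z ^ k = (\<Sum>i\<in>I. of_rat (W k i) * b i)"
  shows "algebraic z"
proof -
  obtain d where d: "\<exists>k\<in>{..card I}. d k \<noteq> 0"
      "\<And>i. i \<in> I \<Longrightarrow> (\<Sum>k\<in>{..card I}. d k * W k i) = 0"
    using ex_linear_relation[of I "{..card I}" W] assms(1) by auto
  define p where "p = (\<Sum>k\<le>card I. monom (of_rat (d k) :: 'a) k)"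
  have coeff_p: "coeff p k = (if k \<le> card I then of_rat (d k) else 0)" for k
    by (simp add: p_def coeff_sum)
  have "poly p z = (\<Sum>k\<le>card I. of_rat (d k) * z ^ k)"
    by (simp add: p_def poly_sum poly_monom)
  also have "\<dots> = (\<Sum>k\<le>card I. \<Sum>i\<in>I. of_rat (d k * W k i) * b i)"
    by (simp only: powers sum_distrib_left of_rat_mult mult.assoc)
  also have "\<dots> = (\<Sum>i\<in>I. of_rat (\<Sum>k\<le>card I. d k * W k i) * b i)"
    by (subst sum.swap) (simp add: of_rat_sum sum_distrib_right)
  also have "\<dots> = 0" using d(2) by simp
  finally have "poly p z = 0" .
  moreover have "p \<noteq> 0"
    using d(1) coeff_p by (metis atMost_iff coeff_0 of_rat_eq_0_iff)
  ultimately show ?thesis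
    by (intro algebraicI'[of p]) (auto simp: coeff_p)
qed

lemma algebraic_powers_in_rational_span:
  fixes z :: "'a :: field_char_0"
  assumes "algebraic z"
  obtains a and r :: "nat \<Rightarrow> nat \<Rightarrow> rat"
  where "\<And>k. z ^ k = (\<Sum>i<a. of_rat (r k i) * z ^ i)"
proof -
  obtain p where p: "\<And>i. coeff p i \<in> \<rat>" "p \<noteq> 0" "poly p z = 0"
    using assms unfolding algebraic_altdef by blast
  define a where "a = degree p"
  have "a \<noteq> 0"
  proof
    assume "a = 0"
    then obtain c where "p = [:c:]" using degree_eq_zeroE unfolding a_def by blast
    then show False using p by simp
  qed
  then obtain a' where a': "a = Suc a'" by (cases a) auto
  have "\<exists>q. coeff p i = of_rat q" for i
    using p(1)[of i] by (elim Rats_cases) blast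
  then obtain q where q: "\<And>i. coeff p i = of_rat (q i)" by metis
  have qa: "q a \<noteq> 0" using q[of a] p(2) by (auto simp: a_def)
  have "0 = (\<Sum>i\<le>a. of_rat (q i) * z ^ i)"
    unfolding p(3)[symmetric] poly_altdef q a_def by (rule refl)
  also have "\<dots> = (\<Sum>i<a. of_rat (q i) * z ^ i) + of_rat (q a) * z ^ a"
    by (simp only: lessThan_Suc_atMost[symmetric] sum.lessThan_Suc)
  finally have "of_rat (q a) * z ^ a = - (\<Sum>i<a. of_rat (q i) * z ^ i)"
    by (metis eq_neg_iff_add_eq_0 add.commute)
  then have "z ^ a = - (\<Sum>i<a. of_rat (q i) * z ^ i) / of_rat (q a)"
    using qa by (metis nonzero_mult_div_cancel_left of_rat_eq_0_iff)
  then have top: "z ^ a = (\<Sum>i<a. of_rat (- q i / q a) * z ^ i)"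
    by (simp only: sum_divide_distrib sum_negf[symmetric] of_rat_divide of_rat_minus)
       (intro sum.cong, simp_all)
  have "\<exists>r. z ^ k = (\<Sum>i<a. of_rat (r i) * z ^ i)" for k
  proof (induction k)
    case 0
    have "(\<Sum>i<a. of_rat (if i = 0 then 1 else 0) * z ^ i)
        = (\<Sum>i\<in>{0}. of_rat (if i = 0 then 1 else 0) * z ^ i)"
      using \<open>a \<noteq> 0\<close> by (intro sum.mono_neutral_right) auto
    then show ?case by (intro exI[of _ "\<lambda>i. if i = 0 then 1 else 0"]) simp
  next
    case (Suc k)
    then obtain r where r: "z ^ k = (\<Sum>i<a. of_rat (r i) * z ^ i)" by blast
    have "z ^ Suc k = (\<Sum>i<Suc a'. of_rat (r i) * z ^ Suc i)"
      unfolding power_Suc r a' sum_distrib_left by (intro sum.cong) (simp_all add: mult_ac)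
    also have "\<dots> = (\<Sum>i<a'. of_rat (r i) * z ^ Suc i) + of_rat (r a') * z ^ a"
      by (simp only: a' sum.lessThan_Suc)
    also have "(\<Sum>i<a'. of_rat (r i) * z ^ Suc i)
        = (\<Sum>i<a. of_rat (case i of 0 \<Rightarrow> 0 | Suc j \<Rightarrow> r j) * z ^ i)"
      unfolding a' by (subst sum.lessThan_Suc_shift) simp
    also have "of_rat (r a') * z ^ a = (\<Sum>i<a. of_rat (r a' * (- q i / q a)) * z ^ i)"
      by (simp only: top sum_distrib_left of_rat_mult mult.assoc)
    finally have "z ^ Suc k = (\<Sum>i<a. of_rat ((case i of 0 \<Rightarrow> 0 | Suc j \<Rightarrow> r j)
        + r a' * (- q i / q a)) * z ^ i)"
      by (simp only: sum.distrib[symmetric] of_rat_add distrib_right)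
    then show ?case
      by (intro exI[of _ "\<lambda>i. (case i of 0 \<Rightarrow> 0 | Suc j \<Rightarrow> r j) + r a' * (- q i / q a)"])
  qed
  then obtain r where "\<And>k. z ^ k = (\<Sum>i<a. of_rat (r k i) * z ^ i)" by metis
  then show ?thesis by (rule that)
qed

text \<open>
  The products \<open>x\<^sup>u y\<^sup>v\<close> all lie in the finite-dimensional rational span of those with \<open>u\<close> and \<open>v\<close>
  below the degrees of \<open>x\<close> and \<open>y\<close>.  Stating this for any \<open>z\<close> whose powers are rational combinations
  of such products treats sums and products of algebraic numbers at once.
\<close>

lemma algebraic_polynomial_expression:
  fixes x y z :: "'a :: field_char_0" and c :: "nat \<Rightarrow> nat \<Rightarrow> nat \<Rightarrow> rat"
  assumes "algebraic x" "algebraic y"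
    and z: "\<And>k. z ^ k = (\<Sum>u\<le>k. \<Sum>v\<le>k. of_rat (c k u v) * (x ^ u * y ^ v))"
  shows "algebraic z"
proof -
  obtain a r where r: "\<And>k. x ^ k = (\<Sum>i<a. of_rat (r k i) * x ^ i)"
    using algebraic_powers_in_rational_span[OF assms(1)] by blast
  obtain b s where s: "\<And>k. y ^ k = (\<Sum>j<b. of_rat (s k j) * y ^ j)"
    using algebraic_powers_in_rational_span[OF assms(2)] by blast
  let ?I = "{..<a} \<times> {..<b}"
  have "x ^ u * y ^ v = (\<Sum>(i,j)\<in>?I. of_rat (r u i * s v j) * (x ^ i * y ^ j))" for u v
    unfolding r[of u] s[of v] sum_product sum.cartesian_product
    by (intro sum.cong) (auto simp: of_rat_mult mult_ac)
  then have mono: "x ^ u * y ^ v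
      = (\<Sum>ij\<in>?I. of_rat (r u (fst ij) * s v (snd ij)) * (x ^ fst ij * y ^ snd ij))" for u v
    unfolding case_prod_unfold .
  define C where "C = (\<lambda>k uv. c k (fst uv) (snd uv))"
  have "z ^ k = (\<Sum>uv\<in>{..k} \<times> {..k}. of_rat (C k uv) * (x ^ fst uv * y ^ snd uv))" for k
    by (simp only: z C_def sum.cartesian_product case_prod_unfold)
  also have "\<dots> k = (\<Sum>uv\<in>{..k} \<times> {..k}. \<Sum>ij\<in>?I.
      of_rat (C k uv * (r (fst uv) (fst ij) * s (snd uv) (snd ij))) * (x ^ fst ij * y ^ snd ij))" for k
    by (intro sum.cong refl, subst mono) (simp only: sum_distrib_left of_rat_mult mult.assoc)
  also have "\<dots> k = (\<Sum>ij\<in>?I. of_rat (\<Sum>uv\<in>{..k} \<times> {..k}.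
      C k uv * (r (fst uv) (fst ij) * s (snd uv) (snd ij))) * (x ^ fst ij * y ^ snd ij))" for k
    by (subst sum.swap) (simp only: of_rat_sum sum_distrib_right)
  finally show ?thesis
    by (intro algebraic_if_powers_in_rational_span[of ?I z "\<lambda>k ij. \<Sum>uv\<in>{..k} \<times> {..k}.
          C k uv * (r (fst uv) (fst ij) * s (snd uv) (snd ij))"
          "\<lambda>ij. x ^ fst ij * y ^ snd ij"]) auto
qed

lemma algebraic_add:
  fixes x y :: "'a :: field_char_0"
  assumes "algebraic x" "algebraic y"
  shows "algebraic (x + y)"
proof (rule algebraic_polynomial_expression[OF assms,
        where c = "\<lambda>k u v. if v = k - u then of_nat (k choose u) else 0"])
  fix k
  have "(\<Sum>u\<le>k. \<Sum>v\<le>k. of_rat (if v = k - u then of_nat (k choose u) else 0) * (x ^ u * y ^ v))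
      = (\<Sum>u\<le>k. \<Sum>v\<in>{k - u}. of_nat (k choose u) * (x ^ u * y ^ v))"
    by (intro sum.cong sum.mono_neutral_cong_right) auto
  then show "(x + y) ^ k = (\<Sum>u\<le>k. \<Sum>v\<le>k.
      of_rat (if v = k - u then of_nat (k choose u) else 0) * (x ^ u * y ^ v))"
    by (simp add: binomial_ring mult.assoc)
qed

lemma algebraic_mult:
  fixes x y :: "'a :: field_char_0"
  assumes "algebraic x" "algebraic y"
  shows "algebraic (x * y)"
proof (rule algebraic_polynomial_expression[OF assms,
        where c = "\<lambda>k u v. if u = k \<and> v = k then 1 else 0"])
  fix k
  have "(\<Sum>u\<le>k. \<Sum>v\<le>k. of_rat (if u = k \<and> v = k then 1 else 0) * (x ^ u * y ^ v))
      = (\<Sum>u\<in>{k}. \<Sum>v\<in>{k}. x ^ u * y ^ v)"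
    by (intro sum.mono_neutral_cong_right) auto
  then show "(x * y) ^ k = (\<Sum>u\<le>k. \<Sum>v\<le>k.
      of_rat (if u = k \<and> v = k then 1 else 0) * (x ^ u * y ^ v))"
    by (simp add: power_mult_distrib)
qed

lemma algebraic_sum:
  fixes f :: "'b \<Rightarrow> 'a :: field_char_0"
  shows "(\<And>x. x \<in> A \<Longrightarrow> algebraic (f x)) \<Longrightarrow> algebraic (sum f A)"
  by (induction A rule: infinite_finite_induct) (auto intro: algebraic_add)

section \<open>Sign changes and harmonic symmetric functions\<close>

text \<open>
  \<open>harm_esym i M\<close> is the \<open>i\<close>-th elementary symmetric function of \<open>1, 1/2, \<dots>, 1/M\<close>, that is, the
  coefficient of \<open>x\<^sup>i\<close> in \<open>\<Prod>l=1..M. 1 + x/l\<close>.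
\<close>

fun harm_esym :: "nat \<Rightarrow> nat \<Rightarrow> rat" where
  "harm_esym 0 M = 1"
| "harm_esym (Suc i) 0 = 0"
| "harm_esym (Suc i) (Suc M) = harm_esym (Suc i) M + harm_esym i M / of_nat (Suc M)"

lemma sum_pos_imp_term_pos:
  fixes f :: "'b \<Rightarrow> 'a :: linordered_ab_group_add"
  assumes "0 < sum f A"
  shows "\<exists>x\<in>A. 0 < f x"
  using assms sum_nonpos[of A f] by (meson not_le)

text \<open>
  There are \<open>k\<close> strict sign changes of \<open>c\<close> up to index \<open>N\<close>, witnessed by indices \<open>p 0 < \<dots> < p k\<close>;
  the factor \<open>s\<close> fixes the sign of the first witness.  The case \<open>k = 0\<close> says that \<open>c\<close>
  is not identically zero up to \<open>N\<close>.
\<close>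

definition alternates :: "nat \<Rightarrow> nat \<Rightarrow> (nat \<Rightarrow> rat) \<Rightarrow> bool" where
  "alternates N k c \<longleftrightarrow> (\<exists>p s. strict_mono_on {..k} p \<and> p k \<le> N \<and>
     (\<forall>j\<le>k. s * (-1) ^ j * c (p j) > 0))"

text \<open>
  A discrete Rolle theorem.  The partial sums start from the empty sum \<open>0\<close> and end with the total
  \<open>0\<close>.  Between two consecutive witnesses of opposite sign, as well as before the first and after the
  last one, the partial sums must move in a prescribed direction, and each such move contains a term
  of \<open>c\<close> of that sign.  So \<open>k + 1\<close> witnesses leave \<open>k + 2\<close> moves.
\<close>

lemma alternates_partial_sums:
  assumes alt: "alternates N k (\<lambda>M. \<Sum>l\<le>M. c l)" and total: "(\<Sum>l\<le>N. c l) = 0"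
  shows "alternates N (Suc k) c"
proof -
  define C where "C = (\<lambda>M. \<Sum>l<M. c l)"
  obtain p s where p: "strict_mono_on {..k} p" "p k \<le> N"
      and pos: "\<And>j. j \<le> k \<Longrightarrow> s * (-1) ^ j * C (Suc (p j)) > 0"
    using alt unfolding alternates_def C_def lessThan_Suc_atMost by blast
  \<comment> \<open>\<open>C M\<close> sums the terms below \<open>M\<close>, so that \<open>C (q (Suc j)) - C (q j)\<close> is the sum of the terms with
    index in \<open>{q j..<q (Suc j)}\<close>, the \<open>j\<close>-th of the \<open>k + 2\<close> blocks cut out by the witnesses.\<close>
  define q where "q = (\<lambda>j. if j = 0 then 0 else if j \<le> Suc k then Suc (p (j - 1)) else Suc N)"
  have qk: "q (Suc (Suc k)) = Suc N" by (simp add: q_def)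
  have q_mono: "q j \<le> q (Suc j)" if "j \<le> Suc k" for j
  proof -
    have "p (j - 1) \<le> p j" if "0 < j" "j \<le> k"
      using p(1) that by (auto simp: strict_mono_on_def less_imp_le)
    then show ?thesis using that p(2) by (auto simp: q_def le_Suc_eq)
  qed
  have C_sgn: "s * (-1) ^ j * C (q (Suc j)) \<ge> 0 \<and> s * (-1) ^ j * C (q j) \<le> 0
      \<and> (s * (-1) ^ j * C (q (Suc j)) > 0 \<or> s * (-1) ^ j * C (q j) < 0)" if "j \<le> Suc k" for j
  proof -
    have 1: "s * (-1) ^ j * C (q (Suc j)) > 0" if "j \<le> k"
      using pos[OF that] that by (simp add: q_def)
    have 2: "s * (-1) ^ j * C (q j) < 0" if "j \<noteq> 0"
    proof -
      obtain i where i: "j = Suc i" using \<open>j \<noteq> 0\<close> by (cases j) auto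
      then show ?thesis using pos[of i] \<open>j \<le> Suc k\<close> by (simp add: q_def)
    qed
    have 3: "C (q 0) = 0" "C (q (Suc (Suc k))) = 0"
      using total by (simp_all add: C_def q_def lessThan_Suc_atMost)
    show ?thesis
    proof (cases "j \<le> k")
      case True
      then show ?thesis using 1 2 3 by (cases "j = 0") force+
    next
      case False
      then have "j = Suc k" using that by simp
      then show ?thesis using 2 3 by force
    qed
  qed
  have ex: "\<exists>l. q j \<le> l \<and> l < q (Suc j) \<and> s * (-1) ^ j * c l > 0" if "j \<le> Suc k" for j
  proof -
    have "(\<Sum>l\<in>{q j..<q (Suc j)}. c l) = C (q (Suc j)) - C (q j)"
      using sum_diff_nat_ivl[of 0 "q j" "q (Suc j)" c] q_mono[OF that]
      by (simp add: C_def atLeast0LessThan)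
    then have "(\<Sum>l\<in>{q j..<q (Suc j)}. s * (-1) ^ j * c l)
        = s * (-1) ^ j * C (q (Suc j)) - s * (-1) ^ j * C (q j)"
      by (simp add: sum_distrib_left[symmetric] right_diff_distrib)
    then have "(\<Sum>l\<in>{q j..<q (Suc j)}. s * (-1) ^ j * c l) > 0"
      using C_sgn[OF that] by linarith
    then show ?thesis
      using sum_pos_imp_term_pos by fastforce
  qed
  then obtain r where r: "\<And>j. j \<le> Suc k \<Longrightarrow> q j \<le> r j \<and> r j < q (Suc j) \<and> s * (-1) ^ j * c (r j) > 0"
    by metis
  have q_less: "q (Suc i) \<le> q j" if "i < j" "j \<le> Suc k" for i j
    using that
  proof (induction j)
    case (Suc j)
    then show ?case using q_mono[of j] by (cases "i = j") auto
  qed simp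
  have "strict_mono_on {..Suc k} r"
    by (rule strict_mono_onI) (use r q_less in \<open>metis atMost_iff less_imp_le order_less_le_trans order_trans\<close>)
  moreover have "r (Suc k) \<le> N" using r[of "Suc k"] qk by auto
  ultimately show ?thesis unfolding alternates_def using r by blast
qed

text \<open>
  Positive weights do not affect signs; this absorbs the factor \<open>1 / (M + 1)\<close> from Abel summation.
\<close>

lemma alternates_cong_pos:
  assumes "alternates N k c" "\<And>M. M \<le> N \<Longrightarrow> c M = g M * C M" "\<And>M. g M > 0"
  shows "alternates N k C"
proof -
  obtain p s where p: "strict_mono_on {..k} p" "p k \<le> N" and pos: "\<And>j. j \<le> k \<Longrightarrow> s * (-1) ^ j * c (p j) > 0"
    using assms(1) unfolding alternates_def by blast
  have "s * (-1) ^ j * C (p j) > 0" if "j \<le> k" for j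
  proof -
    have "p j \<le> p k" using p(1) that by (cases "j = k") (auto simp: strict_mono_on_def less_imp_le)
    then have "g (p j) * (s * (-1) ^ j * C (p j)) > 0"
      using pos[OF that] assms(2)[of "p j"] p(2) by (simp add: mult_ac)
    then show ?thesis using assms(3)[of "p j"] zero_less_mult_pos by blast
  qed
  then show ?thesis using p unfolding alternates_def by blast
qed

text \<open>
  Since \<open>e\<^sub>i\<^sub>+\<^sub>1(M + 1) - e\<^sub>i\<^sub>+\<^sub>1(M) = e\<^sub>i(M) / (M + 1)\<close>, Abel summation turns the equation for \<open>i + 1\<close> into
  the equation for \<open>i\<close> for the weighted partial sums.  The equation for \<open>i = 0\<close> says that the total is
  \<open>0\<close>, which removes the boundary term and makes the discrete Rolle theorem applicable.
\<close>

lemma alternates_if_moments_vanish: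
  fixes c :: "nat \<Rightarrow> rat"
  assumes "\<And>i. i < n \<Longrightarrow> (\<Sum>M\<le>N. c M * harm_esym i M) = 0" and "\<exists>M\<le>N. c M \<noteq> 0"
  shows "alternates N n c"
  using assms
proof (induction n arbitrary: c)
  case 0
  then obtain M where M: "M \<le> N" "c M \<noteq> 0" by blast
  have "sgn (c M) * c M > 0" using M by (simp add: sgn_if)
  then show ?case
    using M unfolding alternates_def
    by (intro exI[of _ "\<lambda>_. M"] exI[of _ "sgn (c M)"]) (auto simp: strict_mono_on_def)
next
  case (Suc n)
  define C where "C = (\<lambda>M. \<Sum>l\<le>M. c l)"
  have CN: "C N = 0" using Suc.prems(1)[of 0] by (simp add: C_def)
  have abel: "(\<Sum>M\<le>N'. c M * harm_esym (Suc i) M)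
      = C N' * harm_esym (Suc i) N' - (\<Sum>M<N'. C M / of_nat (Suc M) * harm_esym i M)" for i N'
  proof (induction N')
    case 0 then show ?case by (simp add: C_def)
  next
    case (Suc K)
    have "C (Suc K) = C K + c (Suc K)" by (simp add: C_def)
    then show ?case using Suc by (simp add: algebra_simps add_divide_distrib)
  qed
  have "alternates N n (\<lambda>M. C M / of_nat (Suc M))"
  proof (rule Suc.IH)
    fix i assume "i < n"
    have "(\<Sum>M\<le>N. C M / of_nat (Suc M) * harm_esym i M) = (\<Sum>M<N. C M / of_nat (Suc M) * harm_esym i M)"
      using CN by (simp add: lessThan_Suc_atMost[symmetric])
    then show "(\<Sum>M\<le>N. C M / of_nat (Suc M) * harm_esym i M) = 0"
      using abel[of i N] Suc.prems(1)[of "Suc i"] CN \<open>i < n\<close> by simp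
  next
    show "\<exists>M\<le>N. C M / of_nat (Suc M) \<noteq> 0"
    proof (rule ccontr)
      assume "\<not> ?thesis"
      then have C0: "C M = 0" if "M \<le> N" for M
        using that by (simp del: of_nat_Suc)
      have "c M = 0" if "M \<le> N" for M
      proof (cases M)
        case 0 then show ?thesis using C0[of 0] by (simp add: C_def)
      next
        case (Suc K)
        have "C (Suc K) = C K + c (Suc K)" by (simp add: C_def)
        then show ?thesis using C0[of M] C0[of K] that Suc by simp
      qed
      then show False using Suc.prems(2) by blast
    qed
  qed
  then have "alternates N n C"
    by (rule alternates_cong_pos[where g = "\<lambda>M. 1 / of_nat (Suc M)"]) auto
  then show ?case
    using alternates_partial_sums[of N n c] CN unfolding C_def by blast
qed

text \<open>
  A dependency supported on \<open>S\<close> has at most \<open>card S\<close> nonzero terms, too few for the \<open>card S\<close> sign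
  changes that the vanishing sums would enforce.
\<close>

lemma harm_esym_columns_independent:
  fixes c :: "nat \<Rightarrow> rat"
  assumes "finite S" and "\<And>i. i < card S \<Longrightarrow> (\<Sum>M\<in>S. c M * harm_esym i M) = 0"
    and "M \<in> S"
  shows "c M = 0"
proof (rule ccontr)
  assume nz: "c M \<noteq> 0"
  define N where "N = Max S"
  define c' where "c' = (\<lambda>M. if M \<in> S then c M else 0)"
  have le: "K \<le> N" if "K \<in> S" for K using that assms(1) by (simp add: N_def)
  have "(\<Sum>M\<le>N. c' M * harm_esym i M) = (\<Sum>M\<in>S. c M * harm_esym i M)" for i
    using le by (intro sum.mono_neutral_cong_right) (auto simp: c'_def)
  then have "alternates N (card S) c'"
    using assms nz le by (intro alternates_if_moments_vanish) (auto simp: c'_def)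
  then obtain p s where p: "strict_mono_on {..card S} p"
      and pos: "\<And>j. j \<le> card S \<Longrightarrow> s * (-1) ^ j * c' (p j) > 0"
    unfolding alternates_def by blast
  have "p j \<in> S" if "j \<le> card S" for j
    using pos[OF that] by (auto simp: c'_def split: if_splits)
  then have "p ` {..card S} \<subseteq> S" by auto
  then have "card (p ` {..card S}) \<le> card S" by (rule card_mono[OF assms(1)])
  moreover have "card (p ` {..card S}) = Suc (card S)"
    using card_image[OF strict_mono_on_imp_inj_on[OF p]] by simp
  ultimately show False by simp
qed

text \<open>
  A square system with independent columns can be solved for every right-hand side.  Adjoining the
  \<open>k\<close>-th unit vector (index \<open>None\<close>) gives one column too many, hence a relation, in which that vector
  occurs because the other columns are independent.
\<close>

lemma harm_esym_columns_span:
  assumes "finite S" and "k < card S"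
  shows "\<exists>c. \<forall>i<card S. (\<Sum>M\<in>S. c M * harm_esym i M) = (if i = k then 1 else 0)"
proof -
  define w where "w = (\<lambda>x i. case x of None \<Rightarrow> if i = k then 1 else 0 | Some M \<Rightarrow> harm_esym i M)"
  define K where "K = insert None (Some ` S)"
  have K: "finite K" "card {..<card S} < card K"
    using assms(1) by (auto simp: K_def card_image)
  obtain d where d: "\<exists>x\<in>K. d x \<noteq> 0" "\<And>i. i < card S \<Longrightarrow> (\<Sum>x\<in>K. d x * w x i) = 0"
    using ex_linear_relation[OF _ K, of w] by auto
  have rel: "d None * (if i = k then 1 else 0) + (\<Sum>M\<in>S. d (Some M) * harm_esym i M) = 0"
    if "i < card S" for i
    using d(2)[OF that] assms(1) by (simp add: K_def w_def sum.reindex)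
  have "d None \<noteq> 0"
  proof
    assume 0: "d None = 0"
    have "d (Some M) = 0" if "M \<in> S" for M
      using harm_esym_columns_independent[OF assms(1) _ that, of "\<lambda>M. d (Some M)"] rel 0 by simp
    then show False using d(1) 0 by (auto simp: K_def)
  qed
  have "(\<Sum>M\<in>S. (- d (Some M) / d None) * harm_esym i M) = (if i = k then 1 else 0)"
    if "i < card S" for i
  proof -
    have "(\<Sum>M\<in>S. (- d (Some M) / d None) * harm_esym i M)
        = - (\<Sum>M\<in>S. d (Some M) * harm_esym i M) / d None"
      by (simp add: sum_negf sum_divide_distrib)
    also have "(\<Sum>M\<in>S. d (Some M) * harm_esym i M) = - (d None * (if i = k then 1 else 0))"
      using rel[OF that] by (simp only: add_eq_0_iff)
    finally show ?thesis using \<open>d None \<noteq> 0\<close> by simp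
  qed
  then show ?thesis
    by (intro exI[of _ "\<lambda>M. - d (Some M) / d None"] allI impI)
qed

section \<open>Newton identities and subset sums\<close>

text \<open>
  The reversed polynomial \<open>\<Prod>x. 1 - x X\<close> rather than \<open>\<Prod>x. X - x\<close>: its \<open>k\<close>-th coefficient is, up to
  sign, the \<open>k\<close>-th elementary symmetric function, whatever the number of factors.
\<close>

definition rev_root_poly :: "'a :: comm_ring_1 list \<Rightarrow> 'a poly" where
  "rev_root_poly xs = (\<Prod>x\<leftarrow>xs. [:1, - x:])"

text \<open>
  Newton's identities are the coefficients of the logarithmic derivative
  \<open>P' = - P (\<Sum>x. x / (1 - x X))\<close>, an identity of formal power series which the product rule
  establishes factor by factor.
\<close>

lemma newton_identity:
  fixes xs :: "'a :: comm_ring_1 list"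
  shows "of_nat (Suc k) * coeff (rev_root_poly xs) (Suc k)
    = - (\<Sum>i\<le>k. coeff (rev_root_poly xs) i * (\<Sum>x\<leftarrow>xs. x ^ Suc (k - i)))"
proof -
  define P where "P = (\<lambda>xs :: 'a list. fps_of_poly (rev_root_poly xs))"
  define G where "G = (\<lambda>xs :: 'a list. Abs_fps (\<lambda>k. \<Sum>x\<leftarrow>xs. x ^ Suc k))"
  have "fps_deriv (P xs) = - (P xs * G xs)"
  proof (induction xs)
    case Nil
    have "G [] = 0" by (rule fps_ext) (simp add: G_def)
    then show ?case by (simp add: P_def rev_root_poly_def)
  next
    case (Cons x xs)
    define L where "L = 1 - fps_const x * fps_X"
    have L: "fps_of_poly [:1, - x:] = L"
      by (simp add: L_def fps_of_poly_pCons flip: fps_const_neg)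
    have P: "P (x # xs) = L * P xs"
      by (simp only: P_def rev_root_poly_def list.map prod_list.Cons fps_of_poly_mult L)
    have dL: "fps_deriv L = - fps_const x" by (simp add: L_def)
    have "L * Abs_fps (\<lambda>k. x ^ Suc k) = fps_const x"
      by (rule fps_ext) (auto simp: L_def left_diff_distrib mult.assoc fps_X_mult_nth
            power_eq_if mult_ac split: nat.splits)
    moreover have "G (x # xs) = Abs_fps (\<lambda>k. x ^ Suc k) + G xs"
      by (rule fps_ext) (simp add: G_def)
    ultimately have LG: "L * G (x # xs) = fps_const x + L * G xs"
      by (simp add: distrib_left)
    have "fps_deriv (P (x # xs)) = - (fps_const x * P xs) - L * (P xs * G xs)"
      by (simp add: P dL Cons.IH del: fps_const_neg)
    also have "\<dots> = - (P xs * (L * G (x # xs)))"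
      unfolding LG by (simp add: algebra_simps)
    finally show ?case by (simp add: P mult_ac)
  qed
  from arg_cong[OF this, of "\<lambda>f. fps_nth f k"] show ?thesis
    by (simp add: P_def G_def fps_mult_nth atLeast0AtMost)
qed

lemma coeff_0_rev_root_poly [simp]: "coeff (rev_root_poly xs) 0 = 1"
  by (induction xs) (auto simp: rev_root_poly_def coeff_mult)

definition is_subring :: "'a :: ring_1 set \<Rightarrow> bool" where
  "is_subring R \<longleftrightarrow> 1 \<in> R \<and> (\<forall>x\<in>R. \<forall>y\<in>R. x - y \<in> R \<and> x * y \<in> R)"

lemma is_subringD:
  assumes "is_subring R"
  shows "0 \<in> R" "1 \<in> R" "x \<in> R \<Longrightarrow> y \<in> R \<Longrightarrow> x - y \<in> R" "x \<in> R \<Longrightarrow> y \<in> R \<Longrightarrow> x * y \<in> R"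
    "x \<in> R \<Longrightarrow> - x \<in> R" "x \<in> R \<Longrightarrow> y \<in> R \<Longrightarrow> x + y \<in> R"
proof -
  show *: "1 \<in> R" "\<And>x y. x \<in> R \<Longrightarrow> y \<in> R \<Longrightarrow> x - y \<in> R" "x \<in> R \<Longrightarrow> y \<in> R \<Longrightarrow> x * y \<in> R"
    using assms unfolding is_subring_def by blast+
  show zero: "0 \<in> R" using *(2)[OF *(1) *(1)] by simp
  show neg: "- x \<in> R" if "x \<in> R" for x using *(2)[OF zero that] by simp
  show "x + y \<in> R" if "x \<in> R" "y \<in> R" using *(2)[OF that(1) neg[OF that(2)]] by simp
qed

lemma is_subring_sum:
  assumes "is_subring R"
  shows "(\<And>x. x \<in> A \<Longrightarrow> f x \<in> R) \<Longrightarrow> sum f A \<in> R"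
  by (induction A rule: infinite_finite_induct) (auto intro: is_subringD[OF assms])

lemma is_subring_Ints: "is_subring (\<int> :: 'a :: ring_1 set)"
  by (simp add: is_subring_def)

lemma is_subring_Rats: "is_subring (\<rat> :: 'a :: field_char_0 set)"
  by (simp add: is_subring_def)

text \<open>
  Newton's identities read as a recursion for the elementary symmetric functions.  It requires
  division by \<open>k\<close>, which is why the subring has to be closed under it.
\<close>

lemma coeff_rev_root_poly_in_subring:
  fixes xs :: "'a :: comm_ring_1 list"
  assumes R: "is_subring R"
    and divide: "\<And>k x. of_nat (Suc k) * x \<in> R \<Longrightarrow> x \<in> R"
    and sums: "\<And>k. k > 0 \<Longrightarrow> (\<Sum>x\<leftarrow>xs. x ^ k) \<in> R"
  shows "coeff (rev_root_poly xs) k \<in> R"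
proof (induction k rule: less_induct)
  case (less k)
  show ?case
  proof (cases k)
    case 0
    then show ?thesis using is_subringD[OF R] by simp
  next
    case (Suc m)
    have "(\<Sum>i\<le>m. coeff (rev_root_poly xs) i * (\<Sum>x\<leftarrow>xs. x ^ Suc (m - i))) \<in> R"
      using less Suc by (intro is_subring_sum[OF R] is_subringD(4)[OF R] sums) auto
    then have "of_nat (Suc m) * coeff (rev_root_poly xs) (Suc m) \<in> R"
      unfolding newton_identity by (intro is_subringD(5)[OF R])
    then show ?thesis using divide Suc by blast
  qed
qed

text \<open>
  Read in the other direction, for the power sums, the recursion involves no division: the term with
  \<open>i = 0\<close> is the highest power sum, with coefficient \<open>1\<close>.  Hence this also works over the integers.
\<close>

lemma power_sum_in_subring:
  fixes xs :: "'a :: comm_ring_1 list"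
  assumes R: "is_subring R" and coeffs: "\<And>k. coeff (rev_root_poly xs) k \<in> R"
  shows "k > 0 \<Longrightarrow> (\<Sum>x\<leftarrow>xs. x ^ k) \<in> R"
proof (induction k rule: less_induct)
  case (less k)
  then obtain m where m: "k = Suc m" by (cases k) auto
  have of_nat: "of_nat j \<in> R" for j
    by (induction j) (auto intro: is_subringD[OF R])
  define T where "T = (\<Sum>i<m. coeff (rev_root_poly xs) (Suc i) * (\<Sum>x\<leftarrow>xs. x ^ Suc (m - Suc i)))"
  have "T \<in> R"
    unfolding T_def using less m
    by (intro is_subring_sum[OF R] is_subringD(4)[OF R] coeffs less.IH) auto
  have "{..m} = insert 0 (Suc ` {..<m})"
    by (auto simp: image_iff less_Suc_eq_0_disj lessThan_Suc_atMost[symmetric])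
  then have "(\<Sum>i\<le>m. coeff (rev_root_poly xs) i * (\<Sum>x\<leftarrow>xs. x ^ Suc (m - i)))
      = (\<Sum>x\<leftarrow>xs. x ^ Suc m) + T"
    unfolding T_def by (simp add: sum.reindex)
  then have "(\<Sum>x\<leftarrow>xs. x ^ Suc m) = - (of_nat (Suc m) * coeff (rev_root_poly xs) (Suc m)) - T"
    using newton_identity[of m xs] by simp
  also have "\<dots> \<in> R"
    using \<open>T \<in> R\<close> by (intro is_subringD[OF R] of_nat coeffs)
  finally show ?case by (simp add: m)
qed

lemma reflect_poly_linear_factors:
  fixes xs :: "'a :: {comm_ring_1,ring_no_zero_divisors} list"
  shows "reflect_poly (\<Prod>x\<leftarrow>xs. [:- x, 1:]) = rev_root_poly xs"
proof (induction xs)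
  case (Cons x xs)
  have "reflect_poly [:- x, 1:] = [:1, - x:]"
    by (simp add: reflect_poly_def)
  then show ?case
    using Cons by (simp only: rev_root_poly_def list.map prod_list.Cons reflect_poly_mult)
qed (simp add: rev_root_poly_def)

lemma prod_one_plus_eq_poly_rev_root_poly:
  "(\<Prod>x\<leftarrow>xs. 1 + x) = poly (rev_root_poly xs) (-1 :: 'a :: comm_ring_1)"
  by (induction xs) (auto simp: rev_root_poly_def distrib_right)

fun subset_sums :: "'a :: comm_monoid_add list \<Rightarrow> 'a list" where
  "subset_sums [] = [0]"
| "subset_sums (x # xs) = subset_sums xs @ map ((+) x) (subset_sums xs)"

lemma zero_in_subset_sums: "0 \<in> set (subset_sums xs)"
  by (induction xs) auto

lemma prod_one_plus_exp:
  fixes xs :: "'a :: {real_normed_field,banach} list"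
  shows "(\<Prod>x\<leftarrow>xs. 1 + exp x) = (\<Sum>s\<leftarrow>subset_sums xs. exp s)"
  by (induction xs) (auto simp: exp_add o_def sum_list_const_mult distrib_right)

lemma prod_one_plus_fps_exp:
  fixes xs :: "'a :: field_char_0 list"
  shows "(\<Prod>x\<leftarrow>xs. 1 + fps_exp x) = (\<Sum>s\<leftarrow>subset_sums xs. fps_exp s)"
  by (induction xs) (auto simp: fps_exp_add_mult o_def sum_list_const_mult distrib_right)

lemma is_subring_rational_fps:
  "is_subring {f :: 'a :: field_char_0 fps. \<forall>n. fps_nth f n \<in> \<rat>}"
  by (auto simp: is_subring_def fps_mult_nth intro!: Rats_sum)

lemma fps_nth_sum_list: "fps_nth (\<Sum>x\<leftarrow>xs. f x) n = (\<Sum>x\<leftarrow>xs. fps_nth (f x) n)"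
  by (induction xs) auto

text \<open>
  The power sums of the series \<open>e\<^sup>x\<^sup>t\<close> are \<open>\<Sum>x. e\<^sup>k\<^sup>x\<^sup>t\<close>, whose coefficients are rational multiples of
  power sums of the \<open>x\<close>.  So Newton's identities over the ring of power series put the elementary
  symmetric functions of these series, and with them \<open>\<Prod>x. 1 + e\<^sup>x\<^sup>t\<close>, into the subring of series with
  rational coefficients.  Expanding the product as a sum of \<open>e\<^sup>s\<^sup>t\<close> over all subset sums \<open>s\<close> exhibits
  their power sums.
\<close>

lemma power_sum_subset_sums_rational:
  fixes xs :: "'a :: field_char_0 list"
  assumes "\<And>k. k > 0 \<Longrightarrow> (\<Sum>x\<leftarrow>xs. x ^ k) \<in> \<rat>"
  shows "(\<Sum>s\<leftarrow>subset_sums xs. s ^ k) \<in> \<rat>"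
proof -
  define R where "R = {f :: 'a fps. \<forall>n. fps_nth f n \<in> \<rat>}"
  have R: "is_subring R" unfolding R_def by (rule is_subring_rational_fps)
  have "f \<in> R" if "of_nat (Suc k) * f \<in> R" for k and f :: "'a fps"
  proof -
    have "fps_nth f n = fps_nth (of_nat (Suc k) * f) n / of_nat (Suc k)" for n
      by (simp del: of_nat_Suc add: fps_of_nat[symmetric] fps_mult_left_const_nth)
    moreover have "fps_nth (of_nat (Suc k) * f) n / of_nat (Suc k) \<in> \<rat>" for n
      using that unfolding R_def by (intro Rats_divide) auto
    ultimately show ?thesis unfolding R_def by simp
  qed
  moreover have "(\<Sum>f\<leftarrow>map fps_exp xs. f ^ k) \<in> R" for k
  proof -
    have "fps_nth (\<Sum>f\<leftarrow>map fps_exp xs. f ^ k) n \<in> \<rat>" for n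
    proof -
      have "fps_nth (\<Sum>f\<leftarrow>map fps_exp xs. f ^ k) n = of_nat k ^ n / fact n * (\<Sum>x\<leftarrow>xs. x ^ n)"
        by (simp add: fps_nth_sum_list o_def fps_exp_power_mult power_mult_distrib
              sum_list_const_mult[symmetric])
      moreover have "(\<Sum>x\<leftarrow>xs. x ^ n) \<in> \<rat>"
        using assms[of n] by (cases "n = 0") (auto simp: sum_list_triv)
      moreover have "(of_nat k ^ n / fact n :: 'a) \<in> \<rat>"
        by (metis Rats_divide Rats_of_nat Rats_power of_nat_fact)
      ultimately show ?thesis by (metis Rats_mult)
    qed
    then show ?thesis by (simp add: R_def)
  qed
  ultimately have "coeff (rev_root_poly (map fps_exp xs)) k \<in> R" for k
    by (intro coeff_rev_root_poly_in_subring[OF R]) auto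
  moreover have "(-1) ^ j \<in> R" for j :: nat
    by (induction j) (auto intro: is_subringD[OF R])
  ultimately have "poly (rev_root_poly (map fps_exp xs)) (-1) \<in> R"
    unfolding poly_altdef by (intro is_subring_sum[OF R] is_subringD(4)[OF R])
  then have "(\<Sum>s\<leftarrow>subset_sums xs. fps_exp s) \<in> R"
    using prod_one_plus_eq_poly_rev_root_poly[of "map fps_exp xs"]
    by (simp add: prod_one_plus_fps_exp o_def)
  then have "fps_nth (\<Sum>s\<leftarrow>subset_sums xs. fps_exp s) k \<in> \<rat>"
    by (simp add: R_def)
  then have "(\<Sum>s\<leftarrow>subset_sums xs. s ^ k) / fact k \<in> \<rat>"
    by (simp add: fps_nth_sum_list divide_inverse sum_list_mult_const)
  then have "(\<Sum>s\<leftarrow>subset_sums xs. s ^ k) / fact k * fact k \<in> \<rat>"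
    by (rule Rats_mult) (metis Rats_of_nat of_nat_fact)
  then show ?thesis by simp
qed

section \<open>Hermite sums of derivatives\<close>

text \<open>
  Hermite's sum of all derivatives, for \<open>g\<close> evaluated at \<open>c x\<close>: the factor \<open>c ^ m\<close> comes from the
  chain rule and lets all evaluation points be multiplied by a common denominator \<open>c\<close>.
\<close>

definition hermite_poly :: "'a :: field_char_0 \<Rightarrow> 'a poly \<Rightarrow> 'a poly" where
  "hermite_poly c g = (\<Sum>m\<le>degree g. smult (c ^ m) ((pderiv ^^ m) g))"

lemma hermite_poly_diff: "hermite_poly c g - smult c (pderiv (hermite_poly c g)) = g"
proof -
  have 0: "(pderiv ^^ Suc (degree g)) g = 0"
    by (rule poly_eqI) (simp only: coeff_higher_pderiv, simp add: coeff_eq_0)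
  define f where "f = (\<lambda>m. smult (c ^ m) ((pderiv ^^ m) g))"
  have F: "hermite_poly c g = (\<Sum>m\<le>degree g. f m)"
    by (simp add: hermite_poly_def f_def)
  have "smult c (pderiv (f m)) = f (Suc m)" for m
    by (simp add: f_def pderiv_smult mult.commute)
  then have "smult c (pderiv (\<Sum>m\<le>n. f m)) = (\<Sum>m\<le>n. f (Suc m))" for n
    by (induction n) (simp_all add: pderiv_add smult_add_right)
  then have "hermite_poly c g - smult c (pderiv (hermite_poly c g))
      = (\<Sum>m\<le>degree g. f m - f (Suc m))"
    unfolding F by (simp add: sum_subtractf)
  also have "\<dots> = f 0 - f (Suc (degree g))" by (rule sum_telescope)
  also have "\<dots> = g" using 0 by (simp add: f_def)
  finally show ?thesis .
qed

text \<open>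
  With \<open>F\<close> the Hermite sum of \<open>g\<close>, the function \<open>e\<^sup>-\<^sup>x F(c x)\<close> has derivative \<open>- e\<^sup>-\<^sup>x g(c x)\<close>, so the mean
  value inequality bounds its change between \<open>0\<close> and \<open>\<beta>\<close>.  Thus \<open>F(c \<beta>)\<close> is
  close to \<open>e\<^sup>\<beta> F(0)\<close> where \<open>g\<close> is small.
\<close>

lemma hermite_poly_exp_bound:
  fixes c \<beta> :: complex
  assumes G: "\<And>x. norm x \<le> norm \<beta> \<Longrightarrow> norm (poly g (c * x)) \<le> G"
  shows "norm (poly (hermite_poly c g) (c * \<beta>) - exp \<beta> * poly (hermite_poly c g) 0)
    \<le> norm \<beta> * exp (2 * norm \<beta>) * G"
proof -
  define F where "F = hermite_poly c g"
  define h where "h = (\<lambda>x. exp (- x) * poly F (c * x))"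
  have deriv: "(h has_field_derivative - exp (- x) * poly g (c * x)) (at x within S)" for x S
  proof -
    have "(h has_field_derivative
        - exp (- x) * poly F (c * x) + exp (- x) * (poly (pderiv F) (c * x) * c)) (at x within S)"
      unfolding h_def
      by (rule derivative_eq_intros poly_DERIV[THEN DERIV_chain2] refl | simp)+
    moreover have g: "poly g (c * x) = poly F (c * x) - c * poly (pderiv F) (c * x)"
      using hermite_poly_diff[of c g] unfolding F_def
      by (metis poly_diff poly_smult)
    have "- exp (- x) * poly F (c * x) + exp (- x) * (poly (pderiv F) (c * x) * c)
        = - exp (- x) * poly g (c * x)"
      unfolding g by (simp add: algebra_simps)
    ultimately show ?thesis by simp
  qed
  have "norm (h \<beta> - h 0) \<le> exp (norm \<beta>) * G * norm (\<beta> - 0)"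
  proof (rule field_differentiable_bound[OF convex_cball[of 0 "norm \<beta>"] deriv])
    fix z :: complex assume "z \<in> cball 0 (norm \<beta>)"
    then have z: "norm z \<le> norm \<beta>" by simp
    have "norm (exp (- z)) \<le> exp (norm \<beta>)"
      using norm_exp[of "- z"] z by (simp add: order_trans)
    then show "norm (- exp (- z) * poly g (c * z)) \<le> exp (norm \<beta>) * G"
      unfolding norm_mult norm_minus_cancel using G[OF z] by (intro mult_mono) auto
  qed auto
  then have bound: "norm (h \<beta> - h 0) \<le> exp (norm \<beta>) * G * norm \<beta>" by simp
  have "poly F (c * \<beta>) - exp \<beta> * poly F 0 = exp \<beta> * (h \<beta> - h 0)"
    by (simp add: h_def right_diff_distrib flip: mult.assoc exp_add)
  then have "norm (poly F (c * \<beta>) - exp \<beta> * poly F 0) = norm (exp \<beta> * (h \<beta> - h 0))"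
    by (rule arg_cong)
  also have "\<dots> \<le> exp (norm \<beta>) * (exp (norm \<beta>) * G * norm \<beta>)"
    unfolding norm_mult using bound norm_exp[of \<beta>] by (intro mult_mono) auto
  also have "\<dots> = norm \<beta> * exp (2 * norm \<beta>) * G"
    unfolding exp_double power2_eq_square by (simp only: mult_ac)
  finally show ?thesis by (simp add: F_def)
qed

lemma poly_higher_pderiv_multiple_root:
  fixes g :: "'a :: field_char_0 poly"
  assumes "[:- a, 1:] ^ n dvd g" and "m < n"
  shows "poly ((pderiv ^^ m) g) a = 0"
  using assms
proof (induction m arbitrary: n g)
  case 0
  then have "[:- a, 1:] dvd g" by (metis dvd_power dvd_trans)
  then have "poly g a = 0" by (simp only: poly_eq_0_iff_dvd)
  then show ?case by simp
next
  case (Suc m)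
  then obtain k where k: "n = Suc k" "m < k" by (cases n) auto
  obtain q where "g = [:- a, 1:] ^ Suc k * q" using Suc.prems k by (auto elim: dvdE)
  then have "pderiv g = [:- a, 1:] ^ k * (smult (of_nat (Suc k)) q + [:- a, 1:] * pderiv q)"
    by (simp only: pderiv_mult pderiv_power_Suc) (simp add: pderiv_pCons algebra_simps)
  then have "[:- a, 1:] ^ k dvd pderiv g" by simp
  then show ?case using Suc.IH k by (simp only: funpow_Suc_right o_apply)
qed

text \<open>
  Differentiating \<open>m\<close> times multiplies coefficients by products of \<open>m\<close> consecutive integers, which
  are divisible by \<open>m!\<close>.
\<close>

lemma coeff_higher_pderiv_div_fact_in_Ints:
  fixes g :: "'a :: field_char_0 poly"
  assumes "coeff g (k + m) \<in> \<int>" and "p \<le> m"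
  shows "coeff ((pderiv ^^ m) g) k / fact p \<in> \<int>"
proof -
  have "(fact p :: int) dvd pochhammer (int (Suc k)) m"
    using dvd_trans[OF fact_dvd[OF assms(2)] fact_dvd_pochhammer] .
  then obtain z where z: "pochhammer (int (Suc k)) m = fact p * z" by (elim dvdE)
  have "pochhammer (of_nat (Suc k)) m = (of_int (pochhammer (int (Suc k)) m) :: 'a)"
    by (metis of_int_of_nat_eq pochhammer_of_nat)
  also have "\<dots> = fact p * of_int z" by (simp only: z of_int_mult of_int_fact)
  finally have "coeff ((pderiv ^^ m) g) k / fact p = of_int z * coeff g (k + m)"
    by (simp only: coeff_higher_pderiv) simp
  then show ?thesis using assms(1) by simp
qed

lemma sum_list_poly_in_Ints:
  fixes xs :: "'a :: comm_ring_1 list"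
  assumes "\<And>k. (\<Sum>x\<leftarrow>xs. x ^ k) \<in> \<int>" and "\<And>k. coeff h k \<in> \<int>"
  shows "(\<Sum>x\<leftarrow>xs. poly h x) \<in> \<int>"
proof -
  have "(\<Sum>x\<leftarrow>xs. poly h x) = (\<Sum>k\<le>degree h. coeff h k * (\<Sum>x\<leftarrow>xs. x ^ k))"
    by (induction xs) (simp_all add: poly_altdef distrib_left sum.distrib)
  then show ?thesis using assms by (auto intro!: Ints_sum)
qed

text \<open>
  At a root of multiplicity \<open>p\<close> the derivatives of order below \<open>p\<close> vanish, and those of order at
  least \<open>p\<close> have coefficients divisible by \<open>p!\<close>.  A single \<open>\<gamma>\<close> need not be rational; integrality comes
  from the power sums and so only holds for the sum over all \<open>\<gamma>\<close>.
\<close>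

lemma sum_list_hermite_poly_in_Ints:
  fixes \<gamma>s :: "'a :: field_char_0 list"
  assumes c: "c \<in> \<int>" and coeffs: "\<And>k. coeff g k \<in> \<int>"
    and sums: "\<And>k. (\<Sum>x\<leftarrow>\<gamma>s. x ^ k) \<in> \<int>"
    and roots: "\<And>\<gamma>. \<gamma> \<in> set \<gamma>s \<Longrightarrow> [:- \<gamma>, 1:] ^ p dvd g"
  shows "(\<Sum>\<gamma>\<leftarrow>\<gamma>s. poly (hermite_poly c g) \<gamma>) / fact p \<in> \<int>"
proof -
  have "(\<Sum>\<gamma>\<leftarrow>\<gamma>s. poly ((pderiv ^^ m) g) \<gamma>) / fact p \<in> \<int>" for m
  proof (cases "m < p")
    case True
    then have "map (poly ((pderiv ^^ m) g)) \<gamma>s = map (\<lambda>_. 0) \<gamma>s"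
      using poly_higher_pderiv_multiple_root[OF roots] by (intro map_cong) auto
    from arg_cong[OF this, of sum_list] show ?thesis by simp
  next
    case False
    have "(\<Sum>\<gamma>\<leftarrow>\<gamma>s. poly (smult (1 / fact p) ((pderiv ^^ m) g)) \<gamma>) \<in> \<int>"
      using coeff_higher_pderiv_div_fact_in_Ints[OF coeffs, of p m] False
      by (intro sum_list_poly_in_Ints sums) auto
    then show ?thesis by (simp add: sum_list_const_mult divide_inverse mult.commute)
  qed
  then have "(\<Sum>m\<le>degree g. c ^ m * ((\<Sum>\<gamma>\<leftarrow>\<gamma>s. poly ((pderiv ^^ m) g) \<gamma>) / fact p)) \<in> \<int>"
    using c by (intro Ints_sum Ints_mult Ints_power)
  also have "(\<Sum>m\<le>degree g. c ^ m * ((\<Sum>\<gamma>\<leftarrow>\<gamma>s. poly ((pderiv ^^ m) g) \<gamma>) / fact p))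
      = (\<Sum>\<gamma>\<leftarrow>\<gamma>s. poly (hermite_poly c g) \<gamma>) / fact p"
    by (induction \<gamma>s)
       (simp_all add: hermite_poly_def poly_sum sum.distrib add_divide_distrib distrib_left
          sum_divide_distrib)
  finally show ?thesis .
qed

text \<open>
  In contrast to the other roots, a zero of order at least \<open>n\<close> at \<open>0\<close> leaves one term divisible by \<open>n!\<close>
  but not evidently by \<open>(n + 1)!\<close>.  With \<open>n + 1\<close> prime this term will prevent cancellation.
\<close>

lemma poly_hermite_poly_0:
  fixes g :: "'a :: field_char_0 poly"
  assumes c: "c \<in> \<int>" and coeffs: "\<And>k. coeff g k \<in> \<int>"
    and low: "\<And>k. k < n \<Longrightarrow> coeff g k = 0"
  shows "(poly (hermite_poly c g) 0 - c ^ n * fact n * coeff g n) / fact (Suc n) \<in> \<int>"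
proof -
  define t where "t = (\<lambda>m. c ^ m * (poly ((pderiv ^^ m) g) 0))"
  have val: "poly ((pderiv ^^ m) g) 0 = fact m * coeff g m" for m
    by (simp add: poly_0_coeff_0 coeff_higher_pderiv pochhammer_fact)
  have zero: "t m = 0" if "m > degree g" for m
    using that by (simp add: t_def val coeff_eq_0)
  have "poly (hermite_poly c g) 0 = (\<Sum>m\<le>degree g. t m)"
    by (simp add: hermite_poly_def poly_sum t_def)
  also have "\<dots> = (\<Sum>m\<le>degree g + n. t m)"
    using zero by (intro sum.mono_neutral_left) auto
  also have "\<dots> = t n + (\<Sum>m\<in>{..degree g + n} - {n}. t m)"
    by (subst sum.remove[of _ n]) auto
  finally have "poly (hermite_poly c g) 0 - t n = (\<Sum>m\<in>{..degree g + n} - {n}. t m)"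
    by simp
  also have "\<dots> / fact (Suc n) = (\<Sum>m\<in>{..degree g + n} - {n}. t m / fact (Suc n))"
    by (rule sum_divide_distrib)
  also have "\<dots> \<in> \<int>"
  proof (rule Ints_sum)
    fix m assume m: "m \<in> {..degree g + n} - {n}"
    show "t m / fact (Suc n) \<in> \<int>"
    proof (cases "m < n")
      case True
      then show ?thesis using low by (simp add: t_def val)
    next
      case False
      then have "coeff ((pderiv ^^ m) g) 0 / fact (Suc n) \<in> \<int>"
        using m by (intro coeff_higher_pderiv_div_fact_in_Ints coeffs) auto
      then have "c ^ m * (coeff ((pderiv ^^ m) g) 0 / fact (Suc n)) \<in> \<int>"
        using c by (intro Ints_mult Ints_power)
      then show ?thesis by (simp add: t_def poly_0_coeff_0)
    qed
  qed
  finally show ?thesis by (simp add: t_def val mult.assoc)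
qed

section \<open>Transcendence of pi\<close>

lemma exists_prime_fact_gt_power:
  fixes K B :: real and n :: nat
  shows "\<exists>p. prime p \<and> p > n \<and> K * B ^ p < fact (p - 1)"
proof -
  have "(\<lambda>m. K * B * (inverse (fact m) * B ^ m)) \<longlonglongrightarrow> K * B * 0"
    by (intro tendsto_mult_left summable_LIMSEQ_zero[OF summable_exp])
  then have "eventually (\<lambda>m. K * B * (inverse (fact m) * B ^ m) < 1) sequentially"
    by (intro order_tendstoD(2)[of _ "0 :: real"]) simp_all
  then obtain N where N: "\<And>m. m \<ge> N \<Longrightarrow> K * B * (inverse (fact m) * B ^ m) < 1"
    unfolding eventually_sequentially by blast
  obtain p where p: "prime p" "p > max n N" using bigger_prime by blast
  then obtain m where m: "p = Suc m" by (cases p) auto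
  have "K * B * (inverse (fact m) * B ^ m) < 1" using p m by (intro N) simp
  then have "K * B * B ^ m < fact m" by (simp add: field_simps)
  then show ?thesis using p m by (intro exI[of _ p]) (simp add: mult.assoc)
qed

lemma norm_sum_list_le:
  fixes f :: "'b \<Rightarrow> 'a :: real_normed_vector"
  shows "norm (\<Sum>x\<leftarrow>xs. f x) \<le> (\<Sum>x\<leftarrow>xs. norm (f x))"
  by (induction xs) (auto intro: norm_triangle_le)

text \<open>
  The heart of the transcendence proof.  Let \<open>\<theta> = (\<Prod>\<gamma>. X - \<gamma>)\<close> and let \<open>F\<close> be the Hermite sum of
  \<open>g = X\<^sup>p\<^sup>-\<^sup>1 \<theta>\<^sup>p\<close> for a large prime \<open>p\<close>.  The number \<open>N = (\<Sum>\<gamma>. F(\<gamma>)) + k F(0)\<close> is \<open>(p - 1)!\<close> times an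
  integer that is congruent to \<open>k c\<^sup>p\<^sup>-\<^sup>1 \<theta>(0)\<^sup>p\<close> modulo \<open>p\<close>, hence nonzero, so \<open>\<bar>N\<bar> \<ge> (p - 1)!\<close>.  If the
  exponential sum vanished, \<open>N\<close> would equal \<open>\<Sum>\<gamma>. F(\<gamma>) - exp (\<gamma> / c) F(0)\<close>, which is
  bounded by \<open>K A\<^sup>p\<close> with constants \<open>K\<close> and \<open>A\<close> independent of \<open>p\<close>, and \<open>(p - 1)!\<close> outgrows this.
\<close>

lemma hermite_nonvanishing:
  fixes \<gamma>s :: "complex list" and c k :: nat
  assumes "c > 0" "k > 0"
    and coeffs: "\<And>j. coeff (\<Prod>\<gamma>\<leftarrow>\<gamma>s. [:- \<gamma>, 1:]) j \<in> \<int>"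
    and sums: "\<And>j. (\<Sum>\<gamma>\<leftarrow>\<gamma>s. \<gamma> ^ j) \<in> \<int>"
    and nonzero: "0 \<notin> set \<gamma>s"
  shows "of_nat k + (\<Sum>\<gamma>\<leftarrow>\<gamma>s. exp (\<gamma> / of_nat c)) \<noteq> 0"
proof
  assume vanish: "of_nat k + (\<Sum>\<gamma>\<leftarrow>\<gamma>s. exp (\<gamma> / of_nat c)) = 0"
  define \<theta> where "\<theta> = (\<Prod>\<gamma>\<leftarrow>\<gamma>s. [:- \<gamma>, 1:])"
  have \<theta>_Ints: "coeff \<theta> j \<in> \<int>" for j using coeffs by (simp add: \<theta>_def)
  obtain t where t: "poly \<theta> 0 = of_int t"
    using \<theta>_Ints[of 0] by (auto simp: poly_0_coeff_0 elim: Ints_cases)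
  have "poly \<theta> 0 \<noteq> 0"
    unfolding \<theta>_def using nonzero by (induction \<gamma>s) auto
  then have "t \<noteq> 0" using t by auto
  define R where "R = (\<Sum>\<gamma>\<leftarrow>\<gamma>s. norm \<gamma>)"
  have R: "norm \<gamma> \<le> R" if "\<gamma> \<in> set \<gamma>s" for \<gamma>
    unfolding R_def using that by (intro member_le_sum_list) auto
  have "R \<ge> 0" unfolding R_def by (intro sum_list_nonneg) auto
  have "compact (poly \<theta> ` cball 0 R)"
    by (intro compact_continuous_image continuous_intros compact_cball)
  then have "bounded (poly \<theta> ` cball 0 R)" by (rule compact_imp_bounded)
  then obtain B0 where "\<forall>y\<in>poly \<theta> ` cball 0 R. norm y \<le> B0"
    unfolding bounded_iff by blast
  then have B0: "norm (poly \<theta> y) \<le> B0" if "norm y \<le> R" for y using that by simp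
  define B where "B = 1 + R + \<bar>B0\<bar>"
  have B: "B \<ge> 1" "R \<le> B" "\<And>y. norm y \<le> R \<Longrightarrow> norm (poly \<theta> y) \<le> B"
    using B0 \<open>R \<ge> 0\<close> unfolding B_def by (auto intro: order_trans[OF B0])
  define K where "K = (\<Sum>\<gamma>\<leftarrow>\<gamma>s. norm (\<gamma> / of_nat c) * exp (2 * norm (\<gamma> / of_nat c)))"
  obtain p where p: "prime p" "p > max k (max c (nat \<bar>t\<bar>))" and small: "K * (B * B) ^ p < fact (p - 1)"
    using exists_prime_fact_gt_power by blast
  obtain n where n: "p = Suc n" using p(1) prime_gt_0_nat gr0_implies_Suc by blast
  define g where "g = monom 1 n * \<theta> ^ p"
  define F where "F = hermite_poly (of_nat c) g"
  define N where "N = (\<Sum>\<gamma>\<leftarrow>\<gamma>s. poly F \<gamma>) + of_nat k * poly F 0"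

  have "coeff (\<theta> ^ j) i \<in> \<int>" for i j
    by (induction j arbitrary: i) (auto simp: coeff_mult \<theta>_Ints intro!: Ints_sum Ints_mult)
  then have g_Ints: "coeff g i \<in> \<int>" for i
    by (simp add: g_def coeff_monom_mult)
  have g_low: "coeff g i = 0" if "i < n" for i
    using that by (simp add: g_def coeff_monom_mult)
  have g_n: "coeff g n = of_int (t ^ p)"
    using t by (simp add: g_def coeff_monom_mult poly_0_coeff_0[symmetric] poly_power)
  have roots: "[:- \<gamma>, 1:] ^ p dvd g" if "\<gamma> \<in> set \<gamma>s" for \<gamma>
  proof -
    have "[:- \<gamma>, 1:] dvd \<theta>"
      unfolding \<theta>_def using that by (intro prod_list_dvd) auto
    then show ?thesis unfolding g_def by (intro dvd_mult dvd_power_same)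
  qed

  have "(\<Sum>\<gamma>\<leftarrow>\<gamma>s. poly F \<gamma>) / fact p \<in> \<int>"
    unfolding F_def using g_Ints sums roots by (intro sum_list_hermite_poly_in_Ints) auto
  then obtain z1 where z1: "(\<Sum>\<gamma>\<leftarrow>\<gamma>s. poly F \<gamma>) = fact p * of_int z1"
    by (elim Ints_cases) (simp add: field_simps)
  have "(poly F 0 - of_nat c ^ n * fact n * coeff g n) / fact (Suc n) \<in> \<int>"
    unfolding F_def using g_Ints g_low by (intro poly_hermite_poly_0) auto
  then obtain z2 where "(poly F 0 - of_nat c ^ n * fact n * of_int (t ^ p)) / fact p = of_int z2"
    unfolding g_n n[symmetric] by (elim Ints_cases)
  then have z2: "poly F 0 = of_nat c ^ n * fact n * of_int (t ^ p) + fact p * of_int z2"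
    by (metis add.commute diff_add_cancel fact_nonzero nonzero_mult_div_cancel_left times_divide_eq_right)
  \<comment> \<open>The first summand of \<open>M\<close> is not divisible by \<open>p\<close>, since \<open>p\<close> exceeds \<open>k\<close>, \<open>c\<close> and \<open>\<bar>t\<bar>\<close>.\<close>
  define M where "M = int k * int c ^ n * t ^ p + int p * (z1 + int k * z2)"
  have "N = fact n * of_int M"
    by (simp add: N_def z1 z2 M_def n algebra_simps)
  moreover have "M \<noteq> 0"
  proof
    assume "M = 0"
    then have "int k * int c ^ n * t ^ p = int p * - (z1 + int k * z2)"
      unfolding M_def by (simp add: algebra_simps)
    then have "int p dvd int k * int c ^ n * t ^ p" by (metis dvd_triv_left)
    moreover have "prime (int p)" using p(1) by simp
    ultimately have "int p dvd int k \<or> int p dvd int c \<or> int p dvd t"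
      by (metis prime_dvd_mult_iff prime_dvd_power)
    then show False
      using p(2) \<open>k > 0\<close> \<open>c > 0\<close> \<open>t \<noteq> 0\<close> zdvd_imp_le[of "int p" "int k"]
        zdvd_imp_le[of "int p" "int c"] zdvd_imp_le[of "int p" "\<bar>t\<bar>"] by auto
  qed
  ultimately have lower: "norm N \<ge> fact n"
  proof -
    assume "N = fact n * of_int M" "M \<noteq> 0"
    then have "norm N = fact n * \<bar>of_int M\<bar>" by (simp add: norm_mult)
    moreover have "\<bar>of_int M :: real\<bar> \<ge> 1" using \<open>M \<noteq> 0\<close> by linarith
    ultimately show ?thesis by simp
  qed

  have term_bound: "norm (poly F \<gamma> - exp (\<gamma> / of_nat c) * poly F 0)
      \<le> norm (\<gamma> / of_nat c) * exp (2 * norm (\<gamma> / of_nat c)) * (B * B) ^ p"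
    if \<gamma>: "\<gamma> \<in> set \<gamma>s" for \<gamma>
  proof -
    have "norm (poly g (of_nat c * x)) \<le> (B * B) ^ p" if "norm x \<le> norm (\<gamma> / of_nat c)" for x
    proof -
      have "norm (of_nat c * x) \<le> R"
        using that R[OF \<gamma>] \<open>c > 0\<close> by (simp add: norm_mult norm_divide field_simps)
      then have 1: "norm (of_nat c * x) \<le> B" "norm (poly \<theta> (of_nat c * x)) \<le> B"
        using B by auto
      have "norm (poly g (of_nat c * x)) = norm (of_nat c * x) ^ n * norm (poly \<theta> (of_nat c * x)) ^ p"
        by (simp only: g_def poly_mult poly_monom poly_power norm_mult norm_power mult_1)
      also have "\<dots> \<le> B ^ n * B ^ p"
        using 1 B(1) by (intro mult_mono power_mono) auto
      also have "\<dots> \<le> B ^ p * B ^ p"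
        using B(1) by (intro mult_right_mono power_increasing) (auto simp: n)
      finally show ?thesis by (simp add: power_mult_distrib)
    qed
    then have "norm (poly F (of_nat c * (\<gamma> / of_nat c)) - exp (\<gamma> / of_nat c) * poly F 0)
        \<le> norm (\<gamma> / of_nat c) * exp (2 * norm (\<gamma> / of_nat c)) * (B * B) ^ p"
      unfolding F_def by (rule hermite_poly_exp_bound)
    then show ?thesis using \<open>c > 0\<close> by (simp add: F_def)
  qed
  have "N = (\<Sum>\<gamma>\<leftarrow>\<gamma>s. poly F \<gamma> - exp (\<gamma> / of_nat c) * poly F 0)"
  proof -
    have "of_nat k = - (\<Sum>\<gamma>\<leftarrow>\<gamma>s. exp (\<gamma> / of_nat c))"
      using vanish by (simp add: eq_neg_iff_add_eq_0)
    then show ?thesis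
      by (simp add: N_def sum_list_subtractf sum_list_mult_const)
  qed
  also have "norm \<dots> \<le> (\<Sum>\<gamma>\<leftarrow>\<gamma>s. norm (poly F \<gamma> - exp (\<gamma> / of_nat c) * poly F 0))"
    by (rule norm_sum_list_le)
  also have "\<dots> \<le> (\<Sum>\<gamma>\<leftarrow>\<gamma>s. norm (\<gamma> / of_nat c) * exp (2 * norm (\<gamma> / of_nat c)) * (B * B) ^ p)"
    by (intro sum_list_mono term_bound)
  also have "\<dots> = K * (B * B) ^ p"
    unfolding K_def by (rule sum_list_mult_const)
  finally show False using lower small by (simp add: n)
qed

text \<open>
  If \<open>c\<close> is a common denominator of the elementary symmetric functions of the \<open>\<beta>\<close>, then the \<open>k\<close>-th one
  of the \<open>c \<beta>\<close> is \<open>c\<^sup>k\<close> times that of the \<open>\<beta>\<close>, an integer for \<open>k \<ge> 1\<close>; for \<open>k = 0\<close> it is \<open>1\<close>.  The power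
  sums follow by the division-free direction of Newton's identities.
\<close>

lemma rational_power_sums_clear_denominators:
  fixes \<beta>s :: "'a :: field_char_0 list"
  assumes "\<And>k. k > 0 \<Longrightarrow> (\<Sum>\<beta>\<leftarrow>\<beta>s. \<beta> ^ k) \<in> \<rat>"
  obtains c :: nat where "c > 0"
    "\<And>k. coeff (\<Prod>\<gamma>\<leftarrow>map ((*) (of_nat c)) \<beta>s. [:- \<gamma>, 1:]) k \<in> \<int>"
    "\<And>k. (\<Sum>\<gamma>\<leftarrow>map ((*) (of_nat c)) \<beta>s. \<gamma> ^ k) \<in> \<int>"
proof -
  define E where "E = rev_root_poly \<beta>s"
  have rat: "coeff E k \<in> \<rat>" for k
    unfolding E_def
  proof (rule coeff_rev_root_poly_in_subring[OF is_subring_Rats])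
    fix k :: nat and x :: 'a
    assume "of_nat (Suc k) * x \<in> \<rat>"
    then have "of_nat (Suc k) * x / of_nat (Suc k) \<in> \<rat>" by (intro Rats_divide) auto
    then show "x \<in> \<rat>" by (simp del: of_nat_Suc)
  qed (use assms in auto)
  have "\<exists>d. d > 0 \<and> of_nat d * coeff E k \<in> \<int>" for k
  proof -
    obtain a b where ab: "b > 0" "coeff E k = of_int a / of_int b"
      using rat[of k] by (elim Rats_cases') blast
    then show ?thesis by (intro exI[of _ "nat b"]) auto
  qed
  then obtain d where d: "\<And>k. d k > 0" "\<And>k. of_nat (d k) * coeff E k \<in> \<int>" by metis
  define c where "c = (\<Prod>k\<le>degree E. d k)"
  have c: "c > 0" using d(1) by (simp add: c_def prod_pos)
  have cE: "of_nat c * coeff E k \<in> \<int>" for k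
  proof (cases "k \<le> degree E")
    case True
    then have "c = d k * (\<Prod>j\<in>{..degree E} - {k}. d j)"
      unfolding c_def by (intro prod.remove) auto
    then have "of_nat c * coeff E k = of_nat (\<Prod>j\<in>{..degree E} - {k}. d j) * (of_nat (d k) * coeff E k)"
      by (simp only: of_nat_mult mult_ac)
    then show ?thesis using d(2) by (metis Ints_mult Ints_of_nat)
  qed (simp add: coeff_eq_0)
  define \<gamma>s where "\<gamma>s = map ((*) (of_nat c)) \<beta>s"
  have scale: "coeff (rev_root_poly (map ((*) a) xs)) k = a ^ k * coeff (rev_root_poly xs) k"
    for a :: 'a and xs k
  proof (induction xs arbitrary: k)
    case (Cons x xs)
    then show ?case
      by (cases k) (auto simp: rev_root_poly_def coeff_pCons algebra_simps)
  next
    case Nil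
    then show ?case by (cases k) (auto simp: rev_root_poly_def)
  qed
  have rev_Ints: "coeff (rev_root_poly \<gamma>s) k \<in> \<int>" for k
  proof (cases k)
    case (Suc j)
    have "coeff (rev_root_poly \<gamma>s) k = of_nat c ^ j * (of_nat c * coeff E k)"
      by (simp add: \<gamma>s_def scale E_def Suc)
    then show ?thesis using cE by (metis Ints_mult Ints_of_nat Ints_power)
  qed simp
  have "coeff (\<Prod>\<gamma>\<leftarrow>\<gamma>s. [:- \<gamma>, 1:]) k \<in> \<int>" for k
  proof -
    define P where "P = (\<Prod>\<gamma>\<leftarrow>\<gamma>s. [:- \<gamma>, 1:])"
    show ?thesis unfolding P_def[symmetric]
    proof (cases "k \<le> degree P")
      case True
      then have "coeff P k = coeff (reflect_poly P) (degree P - k)"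
        by (simp add: coeff_reflect_poly)
      then show "coeff P k \<in> \<int>" using rev_Ints reflect_poly_linear_factors by (metis P_def)
    qed (simp add: coeff_eq_0)
  qed
  moreover have "(\<Sum>\<gamma>\<leftarrow>\<gamma>s. \<gamma> ^ k) \<in> \<int>" for k
  proof (cases "k = 0")
    case True
    then show ?thesis by (simp add: sum_list_triv)
  next
    case False
    then show ?thesis using power_sum_in_subring[OF is_subring_Ints rev_Ints] by simp
  qed
  ultimately show ?thesis using that c unfolding \<gamma>s_def by blast
qed

text \<open>
  Replacing the factor \<open>1 + exp z\<close> by the product over all roots of a rational polynomial makes the
  exponents, the subset sums of the roots, symmetric.  Subset sums equal to \<open>0\<close>, of which the empty one
  is always present, contribute the positive integer \<open>k\<close>; the others are roots \<open>\<beta>\<close> to which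
  Hermite's argument applies.
\<close>

theorem exp_algebraic_neq_minus_one:
  assumes "algebraic (z :: complex)"
  shows "exp z \<noteq> -1"
proof
  assume exp: "exp z = -1"
  obtain q where q: "\<And>i. coeff q i \<in> \<rat>" "q \<noteq> 0" "poly q z = 0"
    using assms unfolding algebraic_altdef by blast
  obtain \<alpha>s where \<alpha>s: "mset \<alpha>s = proots q" using ex_mset by blast
  define P where "P = (\<Prod>\<alpha>\<leftarrow>\<alpha>s. [:- \<alpha>, 1:])"
  have "P = (\<Prod>x\<in>#proots q. [:- x, 1:])"
    unfolding P_def \<alpha>s[symmetric] by (simp flip: prod_mset_prod_list)
  then have qP: "q = smult (lead_coeff q) P" using complex_poly_decompose_multiset[of q] by simp
  have "z \<in> set \<alpha>s" using q \<alpha>s by (metis set_mset_mset set_count_proots mem_Collect_eq)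
  have P_rat: "coeff P k \<in> \<rat>" for k
  proof -
    have "coeff P k = coeff q k / lead_coeff q"
      using q(2) by (subst (1) qP) simp
    then show ?thesis using q(1) by simp
  qed
  have "coeff (rev_root_poly \<alpha>s) k \<in> \<rat>" for k
    unfolding reflect_poly_linear_factors[symmetric] P_def[symmetric] coeff_reflect_poly
    using P_rat by simp
  then have "(\<Sum>\<alpha>\<leftarrow>\<alpha>s. \<alpha> ^ k) \<in> \<rat>" if "k > 0" for k
    using that by (intro power_sum_in_subring[OF is_subring_Rats])
  then have sums: "(\<Sum>s\<leftarrow>subset_sums \<alpha>s. s ^ k) \<in> \<rat>" for k
    by (rule power_sum_subset_sums_rational)
  define \<beta>s where "\<beta>s = filter (\<lambda>s. s \<noteq> 0) (subset_sums \<alpha>s)"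
  define k where "k = length (filter (\<lambda>s. s = 0) (subset_sums \<alpha>s))"
  have "k > 0" unfolding k_def using zero_in_subset_sums[of \<alpha>s]
    by (auto simp: filter_empty_conv)
  have split: "(\<Sum>s\<leftarrow>ss. f s) = of_nat (length (filter (\<lambda>s. s = 0) ss)) * f 0
      + (\<Sum>s\<leftarrow>filter (\<lambda>s. s \<noteq> 0) ss. f s)" for ss and f :: "complex \<Rightarrow> complex"
    by (induction ss) (auto simp: algebra_simps)
  have "(\<Sum>\<beta>\<leftarrow>\<beta>s. \<beta> ^ j) \<in> \<rat>" if "j > 0" for j
    using sums[of j] split[of "\<lambda>s. s ^ j" "subset_sums \<alpha>s"] that by (simp add: \<beta>s_def zero_power)
  then obtain c where c: "c > 0"
      "\<And>k. coeff (\<Prod>\<gamma>\<leftarrow>map ((*) (of_nat c)) \<beta>s. [:- \<gamma>, 1:]) k \<in> \<int>"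
      "\<And>k. (\<Sum>\<gamma>\<leftarrow>map ((*) (of_nat c)) \<beta>s. \<gamma> ^ k) \<in> \<int>"
    using rational_power_sums_clear_denominators by blast
  have "0 \<notin> set (map ((*) (of_nat c)) \<beta>s)"
    using c(1) by (auto simp: \<beta>s_def)
  from hermite_nonvanishing[OF c(1) \<open>k > 0\<close> c(2,3) this]
  have "of_nat k + (\<Sum>\<beta>\<leftarrow>\<beta>s. exp \<beta>) \<noteq> 0"
    using c(1) by (simp add: o_def)
  moreover have "of_nat k + (\<Sum>\<beta>\<leftarrow>\<beta>s. exp \<beta>) = (\<Sum>s\<leftarrow>subset_sums \<alpha>s. exp s)"
    using split[of exp "subset_sums \<alpha>s"] by (simp add: k_def \<beta>s_def)
  moreover have "(\<Prod>\<alpha>\<leftarrow>\<alpha>s. 1 + exp \<alpha>) = 0"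
    using \<open>z \<in> set \<alpha>s\<close> exp by (force simp: prod_list_zero_iff)
  ultimately show False by (simp add: prod_one_plus_exp)
qed

corollary transcendental_pi: "\<not> algebraic (complex_of_real pi)"
proof
  assume "algebraic (complex_of_real pi)"
  then have "algebraic (\<i> * complex_of_real pi)" by (intro algebraic_mult algebraic_ii)
  then have "exp (\<i> * complex_of_real pi) \<noteq> -1" by (rule exp_algebraic_neq_minus_one)
  then show False by simp
qed

section \<open>Derivatives of the Gamma function at positive integers\<close>

lemma higher_deriv_Gamma_plus1:
  assumes "Re z > 0"
  shows "(deriv ^^ Suc n) Gamma (z + 1)
    = z * (deriv ^^ Suc n) Gamma z + of_nat (Suc n) * (deriv ^^ n) Gamma z"
proof -
  define S where "S = {z. Re z > 0}"
  have S: "open S" "z \<in> S" using assms by (simp_all add: S_def open_halfspace_Re_gt)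
  have no_pole: "w \<notin> \<int>\<^sub>\<le>\<^sub>0" if "w \<in> S" for w
    using that by (auto simp: S_def elim!: nonpos_Ints_cases)
  have holo: "Gamma holomorphic_on S"
    using no_pole by (intro holomorphic_Gamma) auto
  have shift: "(\<lambda>w. Gamma (1 * w + 1)) holomorphic_on S"
    using no_pole
    by (intro holomorphic_on_compose_gen[OF _ holo, unfolded o_def] holomorphic_intros)
       (auto simp: S_def)
  have "(deriv ^^ Suc n) Gamma (z + 1) = (deriv ^^ Suc n) (\<lambda>w. Gamma (1 * w + 1)) z"
    using higher_deriv_compose_linear'[OF holo S(1) S(1) S(2), of 1 1 "Suc n"]
    by (simp only: power_one mult_1) (simp add: S_def)
  also have "\<dots> = (deriv ^^ Suc n) (\<lambda>w. w * Gamma w) z"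
    using S no_pole
    by (intro higher_deriv_transform_within_open[OF shift _ S] holomorphic_intros holo)
       (auto intro: Gamma_plus1)
  also have "\<dots> = (\<Sum>i = 0..Suc n. of_nat (Suc n choose i) * (deriv ^^ i) (\<lambda>w. w) z
      * (deriv ^^ (Suc n - i)) Gamma z)"
    by (intro higher_deriv_mult[OF _ holo S] holomorphic_intros)
  also have "\<dots> = (\<Sum>i\<in>{0, 1}. of_nat (Suc n choose i) * (deriv ^^ i) (\<lambda>w. w) z
      * (deriv ^^ (Suc n - i)) Gamma z)"
    by (intro sum.mono_neutral_right) auto
  also have "\<dots> = z * (deriv ^^ Suc n) Gamma z + of_nat (Suc n) * (deriv ^^ n) Gamma z"
    by simp
  finally show ?thesis .
qed

text \<open>
  The \<open>n\<close>-th Taylor coefficient of \<open>\<Gamma>\<close> at \<open>M + 1\<close>, divided by \<open>\<Gamma>(M + 1) = M!\<close>.  The normalisation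
  makes the recurrence in \<open>M\<close> that of \<open>harm_esym\<close>.
\<close>

definition Gamma_coeff :: "nat \<Rightarrow> nat \<Rightarrow> complex" where
  "Gamma_coeff n M = (deriv ^^ n) Gamma (of_nat (Suc M)) / (fact n * fact M)"

lemma Gamma_coeff_0_Suc: "Gamma_coeff 0 (Suc M) = Gamma_coeff 0 M"
proof -
  have "Gamma_coeff 0 M = 1" for M
    using Gamma_fact[of M, where ?'a = complex] by (simp add: Gamma_coeff_def add.commute)
  then show ?thesis by simp
qed

lemma Gamma_coeff_Suc_Suc:
  "Gamma_coeff (Suc n) (Suc M) = Gamma_coeff (Suc n) M + Gamma_coeff n M / of_nat (Suc M)"
proof -
  define z :: complex where "z = of_nat (Suc M)"
  define a where "a = (deriv ^^ Suc n) Gamma z"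
  define b where "b = (deriv ^^ n) Gamma z"
  have z: "z \<noteq> 0" "Re z > 0" unfolding z_def by (simp_all del: of_nat_Suc)
  have z_plus1: "of_nat (Suc (Suc M)) = z + 1" by (simp add: z_def)
  have "(deriv ^^ Suc n) Gamma (of_nat (Suc (Suc M))) = z * a + of_nat (Suc n) * b"
    unfolding z_plus1 a_def b_def by (rule higher_deriv_Gamma_plus1[OF z(2)])
  then have "Gamma_coeff (Suc n) (Suc M)
      = (z * a + of_nat (Suc n) * b) / ((of_nat (Suc n) * fact n) * (z * fact M))"
    by (simp only: Gamma_coeff_def fact_Suc z_def)
  also have "\<dots> = a / ((of_nat (Suc n) * fact n) * fact M) + b / (fact n * fact M) / z"
    using z(1) by (simp add: field_simps del: of_nat_Suc)
  finally show ?thesis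
    by (simp only: Gamma_coeff_def a_def b_def z_def fact_Suc)
qed

text \<open>
  Equivalently, \<open>\<Gamma>(M + 1 + x) = M! (\<Prod>l=1..M. 1 + x/l) \<Gamma>(1 + x)\<close> compared coefficientwise at \<open>x = 0\<close>.
\<close>

lemma Gamma_coeff_expansion:
  "Gamma_coeff n M = (\<Sum>i\<le>n. of_rat (harm_esym i M) * Gamma_coeff (n - i) 0)"
proof (induction M arbitrary: n)
  case 0
  have "(\<Sum>i\<le>n. of_rat (harm_esym i 0) * Gamma_coeff (n - i) 0)
      = (\<Sum>i\<in>{0}. of_rat (harm_esym i 0) * Gamma_coeff (n - i) 0)"
    by (intro sum.mono_neutral_right) (auto simp: gr0_conv_Suc)
  then show ?case by simp
next
  case (Suc M)
  show ?case
  proof (cases n)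
    case 0
    then show ?thesis using Suc[of 0] by (simp add: Gamma_coeff_0_Suc)
  next
    case (Suc k)
    have "(\<Sum>i\<le>Suc k. of_rat (harm_esym i (Suc M)) * Gamma_coeff (Suc k - i) 0)
        = Gamma_coeff (Suc k) 0
          + (\<Sum>i\<le>k. of_rat (harm_esym (Suc i) (Suc M)) * Gamma_coeff (k - i) 0)"
      by (simp add: sum.atMost_Suc_shift del: harm_esym.simps(3) sum.atMost_Suc)
    also have "(\<Sum>i\<le>k. of_rat (harm_esym (Suc i) (Suc M)) * Gamma_coeff (k - i) 0)
        = (\<Sum>i\<le>k. of_rat (harm_esym (Suc i) M) * Gamma_coeff (k - i) 0)
          + (\<Sum>i\<le>k. of_rat (harm_esym i M) * Gamma_coeff (k - i) 0) / of_nat (Suc M)"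
      by (simp add: of_rat_add of_rat_divide distrib_right sum.distrib sum_divide_distrib
            del: of_nat_Suc)
    also have "Gamma_coeff (Suc k) 0
          + ((\<Sum>i\<le>k. of_rat (harm_esym (Suc i) M) * Gamma_coeff (k - i) 0)
          + (\<Sum>i\<le>k. of_rat (harm_esym i M) * Gamma_coeff (k - i) 0) / of_nat (Suc M))
        = (\<Sum>i\<le>Suc k. of_rat (harm_esym i M) * Gamma_coeff (Suc k - i) 0)
          + (\<Sum>i\<le>k. of_rat (harm_esym i M) * Gamma_coeff (k - i) 0) / of_nat (Suc M)"
      by (simp add: sum.atMost_Suc_shift del: sum.atMost_Suc of_nat_Suc)
    also have "\<dots> = Gamma_coeff (Suc k) M + Gamma_coeff k M / of_nat (Suc M)"
      by (simp only: Suc.IH)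
    finally show ?thesis
      using \<open>n = Suc k\<close> by (simp only: Gamma_coeff_Suc_Suc)
  qed
qed

text \<open>
  A rational combination of the expansions at the points of \<open>S\<close> isolates a single Taylor coefficient
  at \<open>1\<close>.  The term \<open>i = n\<close> lies outside the range of the inverted system, but it only contributes a
  rational number, since \<open>Gamma_coeff 0 0 = \<Gamma>(1) = 1\<close>.
\<close>

lemma Gamma_coeff_at_1_algebraic:
  assumes "finite S" "k < card S" and alg: "\<And>M. M \<in> S \<Longrightarrow> algebraic (Gamma_coeff (card S) M)"
  shows "algebraic (Gamma_coeff (card S - k) 0)"
proof -
  define n where "n = card S"
  obtain c where c: "\<And>i. i < n \<Longrightarrow> (\<Sum>M\<in>S. c M * harm_esym i M) = (if i = k then 1 else 0)"
    using harm_esym_columns_span[OF assms(1,2)] unfolding n_def by blast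
  have [simp]: "Gamma_coeff 0 0 = 1" by (simp add: Gamma_coeff_def)
  define q where "q = (\<Sum>M\<in>S. c M * harm_esym n M)"
  have "(\<Sum>M\<in>S. of_rat (c M) * Gamma_coeff n M)
      = (\<Sum>i\<le>n. of_rat (\<Sum>M\<in>S. c M * harm_esym i M) * Gamma_coeff (n - i) 0)"
    unfolding Gamma_coeff_expansion[of n] sum_distrib_left of_rat_sum sum_distrib_right
    by (subst sum.swap) (simp add: of_rat_mult mult.assoc)
  also have "\<dots> = (\<Sum>i<n. of_rat (\<Sum>M\<in>S. c M * harm_esym i M) * Gamma_coeff (n - i) 0) + of_rat q"
    by (simp add: q_def flip: lessThan_Suc_atMost)
  also have "(\<Sum>i<n. of_rat (\<Sum>M\<in>S. c M * harm_esym i M) * Gamma_coeff (n - i) 0)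
      = (\<Sum>i<n. if i = k then Gamma_coeff (n - i) 0 else 0)"
    by (intro sum.cong) (auto simp: c)
  also have "\<dots> = Gamma_coeff (n - k) 0"
    using assms(2) by (simp add: n_def)
  finally have "Gamma_coeff (n - k) 0 = (\<Sum>M\<in>S. of_rat (c M) * Gamma_coeff n M) + of_rat (- q)"
    by (simp add: of_rat_minus)
  moreover have "algebraic \<dots>"
    using alg by (intro algebraic_add algebraic_sum algebraic_mult) (auto simp: n_def intro: rat_imp_algebraic)
  ultimately show ?thesis by (simp add: n_def)
qed

lemma deriv_Gamma_1: "deriv Gamma (1 :: complex) = - euler_mascheroni"
  using has_field_derivative_Gamma[of "1 :: complex"] by (simp add: DERIV_imp_deriv)

lemma Polygamma_1_1: "Polygamma 1 (1 :: complex) = of_real (pi\<^sup>2 / 6)"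
proof -
  have "(\<lambda>k. inverse ((1 + of_nat k :: complex) ^ Suc 1))
      = (\<lambda>k. of_real (1 / (real k + 1)\<^sup>2))"
    by (rule ext) (simp add: inverse_eq_divide power2_eq_square algebra_simps)
  also have "\<dots> sums of_real (pi\<^sup>2 / 6)"
    using sums_of_real[OF inverse_squares_sums, where ?'a = complex] by (simp add: add.commute)
  finally show ?thesis by (simp add: Polygamma_def sums_iff)
qed

text \<open>
  From \<open>\<Gamma>' = \<Gamma> \<psi>\<close> one gets \<open>\<Gamma>'' = \<Gamma> (\<psi>\<^sup>2 + \<psi>')\<close>, and \<open>\<psi>'(1)\<close> is the sum of the inverse squares.
\<close>

lemma deriv_deriv_Gamma_1:
  "deriv (deriv Gamma) (1 :: complex) = euler_mascheroni\<^sup>2 + of_real (pi\<^sup>2 / 6)"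
proof -
  have "eventually (\<lambda>z :: complex. z \<in> {z. Re z > 0}) (nhds 1)"
    by (intro eventually_nhds_in_open open_halfspace_Re_gt) auto
  then have "eventually (\<lambda>z :: complex. deriv Gamma z = Gamma z * Digamma z) (nhds 1)"
    by eventually_elim
       (auto elim!: nonpos_Ints_cases intro!: DERIV_imp_deriv has_field_derivative_Gamma)
  then have "(deriv Gamma has_field_derivative euler_mascheroni\<^sup>2 + of_real (pi\<^sup>2 / 6)) (at (1 :: complex))
      \<longleftrightarrow> ((\<lambda>z. Gamma z * Digamma z) has_field_derivative
        euler_mascheroni\<^sup>2 + of_real (pi\<^sup>2 / 6)) (at (1 :: complex))"
    by (intro DERIV_cong_ev refl)
  moreover have "((\<lambda>z :: complex. Gamma z * Digamma z) has_field_derivative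
      euler_mascheroni\<^sup>2 + of_real (pi\<^sup>2 / 6)) (at 1)"
    using Polygamma_1_1
    by (auto intro!: derivative_eq_intros simp: power2_eq_square)
  ultimately show ?thesis by (intro DERIV_imp_deriv) simp
qed

text \<open>
  Eliminating Euler's constant from \<open>\<Gamma>'(1)\<close> and \<open>\<Gamma>''(1)\<close> leaves \<open>\<pi>\<^sup>2 / 6\<close>.
\<close>

lemma algebraic_Gamma_coeff_1_2_contradiction:
  assumes "algebraic (Gamma_coeff 1 0)" "algebraic (Gamma_coeff 2 0)"
  shows False
proof -
  have "Gamma_coeff 1 0 = - euler_mascheroni"
    by (simp add: Gamma_coeff_def deriv_Gamma_1)
  moreover have "Gamma_coeff 2 0 * 12 = 6 * (euler_mascheroni\<^sup>2) + (complex_of_real pi)\<^sup>2"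
    by (simp add: Gamma_coeff_def numeral_2_eq_2 deriv_deriv_Gamma_1[unfolded numeral_2_eq_2])
  ultimately have "(complex_of_real pi)\<^sup>2
      = 12 * Gamma_coeff 2 0 + (- 6) * (Gamma_coeff 1 0 * Gamma_coeff 1 0)"
    by (simp add: power2_eq_square algebra_simps)
  moreover have "algebraic \<dots>"
    using assms by (intro algebraic_add algebraic_mult algebraic_minus algebraic_numeral)
  ultimately have "algebraic ((complex_of_real pi)\<^sup>2)" by simp
  then have "algebraic (complex_of_real pi)"
    by (rule algebraic_root[where p = "monom 1 2"]) (auto simp: poly_monom degree_monom_eq)
  then show False using transcendental_pi by blast
qed

theorem theorem1:
  fixes n :: nat
  assumes "n \<ge> 2"
  shows "finite {m :: nat. m \<ge> 1 \<and> algebraic ((deriv ^^ n) Gamma (of_nat m :: complex))} \<and>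
         card {m :: nat. m \<ge> 1 \<and> algebraic ((deriv ^^ n) Gamma (of_nat m :: complex))} \<le> n - 1"
proof -
  define A where "A = {m :: nat. m \<ge> 1 \<and> algebraic ((deriv ^^ n) Gamma (of_nat m :: complex))}"
  have "finite A \<and> card A \<le> n - 1"
  proof (rule ccontr)
    assume "\<not> (finite A \<and> card A \<le> n - 1)"
    then have "infinite A \<or> n \<le> card A" by auto
    then obtain T where T: "T \<subseteq> A" "finite T" "card T = n"
      by (metis infinite_arbitrarily_large obtain_subset_with_card_n)
    define S where "S = (\<lambda>m. m - 1) ` T"
    have pos: "1 \<le> m" if "m \<in> T" for m
      using T(1) that by (auto simp: A_def)
    have "inj_on (\<lambda>m. m - 1) T"
      by (rule inj_onI) (use pos eq_diff_iff in blast)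
    then have S: "finite S" "card S = n"
      using T by (auto simp: S_def card_image)
    have "algebraic (Gamma_coeff (card S) M)" if "M \<in> S" for M
    proof -
      have "algebraic ((deriv ^^ n) Gamma (of_nat (Suc M) :: complex))"
        using that T(1) by (auto simp: S_def A_def simp del: of_nat_Suc)
      moreover have "algebraic (inverse (fact n * fact M) :: complex)"
        by (metis algebraic_inverse algebraic_of_nat of_nat_fact of_nat_mult)
      ultimately show ?thesis
        unfolding Gamma_coeff_def S(2) divide_inverse by (rule algebraic_mult)
    qed
    then have "algebraic (Gamma_coeff (n - k) 0)" if "k < n" for k
      using Gamma_coeff_at_1_algebraic[of S k] S that by simp
    from this[of "n - 1"] this[of "n - 2"] show False
      using assms algebraic_Gamma_coeff_1_2_contradiction by simp
  qed
  then show ?thesis unfolding A_def .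
qed

end
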